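(* Let $\mathcal{P}$ and $\mathcal{Q}$ be finite chiral or directly regular $n$-polytopes, not both directly regular. Suppose that $|X(\mathcal{P})|$ does not divide $|\Gamma^+(\mathcal{Q})|$ or that $|X(\mathcal{Q})|$ does not divide $|\Gamma^+(\mathcal{P})|$. Then $\mathcal{P}\diamond\mathcal{Q}$ is chiral.
   Context: All polytopes are abstract polytopes. A regular polytope is directly regular if its rotation group $\Gamma^+(\mathcal{P})$, generated by $\sigma_i=\rho_{i-1}\rho_i$ ($\rho_0,\dots,\rho_{n-1}$ the standard generating involutions relative to a base flag), has index $2$ in the automorphism group. A polytope is chiral if its automorphism group has two orbits on flags, adjacent flags lying in distinct orbits; then $\Gamma^+(\mathcal{P})$ is the full automorphism group, generated by standard rotations $\sigma_1,\dots,\sigma_{n-1}$. Let $W^+=\langle \sigma_1,\dots,\sigma_{n-1}\mid (\sigma_i\cdots\sigma_j)^2=1,\ 1\le i<j\le n-1\rangle$; each such $\Gamma^+(\mathcal{P})$ equals $W^+/M$ for a normal subgroup $M$, generators corresponding. Let $w\mapsto\overline{w}$ be the automorphism of $W^+$ with $\sigma_1\mapsto\sigma_1^{-1}$, $\sigma_2\mapsto\sigma_1^2\sigma_2$, $\sigma_j\mapsto\sigma_j$ ($j\ge3$), and $\overline{M}=\{\overline w: w\in M\}$. Mix: if $\Gamma^+(\mathcal{P})=W^+/M$ and $\Gamma^+(\mathcal{Q})=W^+/K$, the mix $\mathcal{P}\diamond\mathcal{Q}$ is the (flag-connected pre-)polytope whose rotation group is the subgroup of $\Gamma^+(\mathcal{P})\times\Gamma^+(\mathcal{Q})$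 generated by $(\sigma_i,\sigma_i')$, which is isomorphic to $W^+/N$ with $N=M\cap K$; it is directly regular if $\overline N=N$ and chiral otherwise (polytopality is not asserted). Chirality group: for $\Gamma^+(\mathcal{P})=W^+/M$, $X(\mathcal{P})$ is the kernel of the natural epimorphism $W^+/M\to W^+/(M\overline{M})$, i.e. $X(\mathcal{P})=M\overline{M}/M$ (isomorphic to $M/(M\cap\overline M)$, the kernel of the natural map from $W^+/(M\cap\overline M)$, the rotation group of $\mathcal{P}\diamond\overline{\mathcal{P}}$, onto $W^+/\overline M$). *)

theory Defs
  imports "HOL-Algebra.Algebra"
begin

section \<open>Abstract polytopes\<close>

text \<open>
  A poset is given by its (reflexive) order relation \<^term>\<open>P\<close>; its set of faces is
  \<^term>\<open>Field P\<close>. Flags are the maximal chains.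
\<close>

definition flags :: "'a rel \<Rightarrow> 'a set set" where
  "flags P = {\<Phi> \<in> Chains P. \<forall>C \<in> Chains P. \<Phi> \<subseteq> C \<longrightarrow> C = \<Phi>}"

text \<open>
  Ranks run from \<^term>\<open>- 1 :: int\<close> (least face) to \<open>n\<close> (greatest face): a face of rank \<open>i\<close> has
  exactly \<open>i + 1\<close> faces strictly below it in a flag through it.
\<close>

definition has_rank :: "'a rel \<Rightarrow> 'a \<Rightarrow> int \<Rightarrow> bool" where
  "has_rank P F i \<longleftrightarrow>
     (\<exists>\<Phi> \<in> flags P. F \<in> \<Phi> \<and> int (card {G \<in> \<Phi>. (G, F) \<in> P \<and> G \<noteq> F}) = i + 1)"

definition adjacent :: "'a rel \<Rightarrow> 'a set \<Rightarrow> 'a set \<Rightarrow> bool" where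
  "adjacent P \<Phi> \<Psi> \<longleftrightarrow>
     \<Phi> \<in> flags P \<and> \<Psi> \<in> flags P \<and> card (\<Phi> - \<Psi>) = 1 \<and> card (\<Psi> - \<Phi>) = 1"

definition i_adjacent :: "'a rel \<Rightarrow> nat \<Rightarrow> 'a set \<Rightarrow> 'a set \<Rightarrow> bool" where
  "i_adjacent P i \<Phi> \<Psi> \<longleftrightarrow> adjacent P \<Phi> \<Psi> \<and> (\<forall>F \<in> \<Phi> - \<Psi>. has_rank P F (int i))"

definition strongly_flag_connected :: "'a rel \<Rightarrow> bool" where
  "strongly_flag_connected P \<longleftrightarrow>
     (\<forall>\<Phi> \<in> flags P. \<forall>\<Psi> \<in> flags P.
        (\<Phi>, \<Psi>) \<in> {(A, B). adjacent P A B \<and> \<Phi> \<inter> \<Psi> \<subseteq> A \<and> \<Phi> \<inter> \<Psi> \<subseteq> B}\<^sup>*)"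

definition diamond_condition :: "'a rel \<Rightarrow> bool" where
  "diamond_condition P \<longleftrightarrow>
     (\<forall>F G i. (F, G) \<in> P \<and> has_rank P F (i - 1) \<and> has_rank P G (i + 1) \<longrightarrow>
        card {H. (F, H) \<in> P \<and> (H, G) \<in> P \<and> H \<noteq> F \<and> H \<noteq> G} = 2)"

definition abstract_polytope :: "nat \<Rightarrow> 'a rel \<Rightarrow> bool" where
  "abstract_polytope n P \<longleftrightarrow>
     Partial_order P \<and>
     (\<exists>F \<in> Field P. \<forall>G \<in> Field P. (F, G) \<in> P) \<and>
     (\<exists>F \<in> Field P. \<forall>G \<in> Field P. (G, F) \<in> P) \<and>
     (\<forall>\<Phi> \<in> flags P. card \<Phi> = n + 2) \<and>
     strongly_flag_connected P \<and>
     diamond_condition P"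


section \<open>Automorphisms, regularity and chirality\<close>

definition polytope_auto :: "'a rel \<Rightarrow> ('a \<Rightarrow> 'a) monoid" where
  "polytope_auto P = BijGroup (Field P)
     \<lparr>carrier := {f \<in> Bij (Field P).
        \<forall>F \<in> Field P. \<forall>G \<in> Field P. (f F, f G) \<in> P \<longleftrightarrow> (F, G) \<in> P}\<rparr>"

definition flag_orbit :: "'a rel \<Rightarrow> 'a set \<Rightarrow> 'a set set" where
  "flag_orbit P \<Phi> = orbit (polytope_auto P) (\<lambda>f. image f) \<Phi>"

definition flag_orbits :: "'a rel \<Rightarrow> 'a set set set" where
  "flag_orbits P = orbits (polytope_auto P) (flags P) (\<lambda>f. image f)"

definition regular_polytope :: "nat \<Rightarrow> 'a rel \<Rightarrow> bool" where
  "regular_polytope n P \<longleftrightarrow> abstract_polytope n P \<and> card (flag_orbits P) = 1"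

definition chiral_polytope :: "nat \<Rightarrow> 'a rel \<Rightarrow> bool" where
  "chiral_polytope n P \<longleftrightarrow>
     abstract_polytope n P \<and> card (flag_orbits P) = 2 \<and>
     (\<forall>\<Phi> \<Psi>. adjacent P \<Phi> \<Psi> \<longrightarrow> flag_orbit P \<Phi> \<noteq> flag_orbit P \<Psi>)"

definition reflection :: "'a rel \<Rightarrow> 'a set \<Rightarrow> nat \<Rightarrow> 'a \<Rightarrow> 'a" where
  "reflection P \<Phi> i = (THE f. f \<in> carrier (polytope_auto P) \<and> i_adjacent P i \<Phi> (f ` \<Phi>))"

text \<open>
  The standard rotations relative to the base flag \<open>\<Phi>\<close>. In the regular case they are
  \<open>\<rho>\<^sub>i\<^sub>-\<^sub>1 \<rho>\<^sub>i\<close>. In the chiral case the reflections do not exist, and \<open>\<sigma>\<^sub>i\<close> is the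
  automorphism that takes \<open>\<Phi>\<close> to the flag \<open>\<rho>\<^sub>i\<^sub>-\<^sub>1 \<rho>\<^sub>i\<close> would take it to. As \<^const>\<open>BijGroup\<close>
  lets automorphisms act from the left, that flag is the \<open>i\<close>-adjacent flag of the
  \<open>(i - 1)\<close>-adjacent flag of \<open>\<Phi>\<close>. Letting automorphisms act from the right (and so taking the
  two adjacencies in the opposite order) leads to the same relations between
  the \<open>\<sigma>\<^sub>i\<close>: a word of adjacencies fixes \<open>\<Phi>\<close> iff the reversed word does.
\<close>

definition rotation :: "'a rel \<Rightarrow> 'a set \<Rightarrow> nat \<Rightarrow> 'a \<Rightarrow> 'a" where
  "rotation P \<Phi> i =
     (if card (flag_orbits P) = 1
      then reflection P \<Phi> (i - 1) \<otimes>\<^bsub>polytope_auto P\<^esub> reflection P \<Phi> i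
      else (THE f. f \<in> carrier (polytope_auto P) \<and>
              (\<exists>\<Psi>. i_adjacent P (i - 1) \<Phi> \<Psi> \<and> i_adjacent P i \<Psi> (f ` \<Phi>))))"

definition rotation_group :: "nat \<Rightarrow> 'a rel \<Rightarrow> 'a set \<Rightarrow> ('a \<Rightarrow> 'a) monoid" where
  "rotation_group n P \<Phi> = subgroup_generated (polytope_auto P) (rotation P \<Phi> ` {1..<n})"

definition directly_regular_polytope :: "nat \<Rightarrow> 'a rel \<Rightarrow> 'a set \<Rightarrow> bool" where
  "directly_regular_polytope n P \<Phi> \<longleftrightarrow>
     regular_polytope n P \<and>
     card (rcosets\<^bsub>polytope_auto P\<^esub> (carrier (rotation_group n P \<Phi>))) = 2"


section \<open>Groups given by generators and relations\<close>

text \<open>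
  A word is a list of letters \<open>(x, b)\<close>, where \<open>(x, True)\<close> stands for the generator \<open>x\<close> and
  \<open>(x, False)\<close> for its inverse. \<open>word_eq S R\<close> is the congruence on words over \<open>S\<close> generated by free
  cancellation and by the relators \<open>R\<close>.
\<close>

type_synonym 'g word = "('g \<times> bool) list"

inductive word_eq :: "'g set \<Rightarrow> 'g word set \<Rightarrow> 'g word \<Rightarrow> 'g word \<Rightarrow> bool"
  for S :: "'g set" and R :: "'g word set" where
  refl: "u \<in> lists (S \<times> UNIV) \<Longrightarrow> word_eq S R u u"
| sym: "word_eq S R u v \<Longrightarrow> word_eq S R v u"
| trans: "word_eq S R u v \<Longrightarrow> word_eq S R v w \<Longrightarrow> word_eq S R u w"
| append: "word_eq S R u u' \<Longrightarrow> word_eq S R v v' \<Longrightarrow> word_eq S R (u @ v) (u' @ v')"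
| cancel: "x \<in> S \<Longrightarrow> word_eq S R [(x, b), (x, \<not> b)] []"
| relator: "r \<in> R \<Longrightarrow> r \<in> lists (S \<times> UNIV) \<Longrightarrow> word_eq S R r []"

definition presented_group :: "'g set \<Rightarrow> 'g word set \<Rightarrow> 'g word set monoid" where
  "presented_group S R =
     \<lparr>carrier = lists (S \<times> UNIV) // {(u, v). word_eq S R u v},
      monoid.mult = (\<lambda>A B. {w. \<exists>u \<in> A. \<exists>v \<in> B. word_eq S R (u @ v) w}),
      one = {w. word_eq S R [] w}\<rparr>"

definition word_value :: "('h, 'm) monoid_scheme \<Rightarrow> ('g \<Rightarrow> 'h) \<Rightarrow> 'g word \<Rightarrow> 'h" where
  "word_value G s w =
     foldr (\<lambda>(x, b) g. (if b then s x else inv\<^bsub>G\<^esub> (s x)) \<otimes>\<^bsub>G\<^esub> g) w \<one>\<^bsub>G\<^esub>"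

text \<open>
  The homomorphism from a presented group to \<open>G\<close> sending each generator \<open>x\<close> to \<open>s x\<close>; it is
  meaningful if the \<open>s x\<close> satisfy the relations, so that all words in a class have the same value.
\<close>

definition induced_hom :: "('h, 'm) monoid_scheme \<Rightarrow> ('g \<Rightarrow> 'h) \<Rightarrow> 'g word set \<Rightarrow> 'h" where
  "induced_hom G s A = the_elem (word_value G s ` A)"


section \<open>The group \<open>W\<^sup>+\<close>, chirality groups and mixes\<close>

definition Wplus_relators :: "nat \<Rightarrow> nat word set" where
  "Wplus_relators n =
     {r @ r | r. \<exists>i j. 1 \<le> i \<and> i < j \<and> j < n \<and> r = map (\<lambda>k. (k, True)) [i..<Suc j]}"

definition Wplus :: "nat \<Rightarrow> nat word set monoid" where
  "Wplus n = presented_group {1..<n} (Wplus_relators n)"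

definition Wplus_gen :: "nat \<Rightarrow> nat \<Rightarrow> nat word set" where
  "Wplus_gen n i = {w. word_eq {1..<n} (Wplus_relators n) [(i, True)] w}"

text \<open>The automorphism (usually written with an overline) that passes to the enantiomorphic form:
  \<open>\<sigma>\<^sub>1 \<mapsto> \<sigma>\<^sub>1\<close> inverse, \<open>\<sigma>\<^sub>2 \<mapsto> \<sigma>\<^sub>1 \<sigma>\<^sub>1 \<sigma>\<^sub>2\<close>, and \<open>\<sigma>\<^sub>j \<mapsto> \<sigma>\<^sub>j\<close> for larger \<open>j\<close>.\<close>

definition Wbar :: "nat \<Rightarrow> nat word set \<Rightarrow> nat word set" where
  "Wbar n = induced_hom (Wplus n)
     (\<lambda>i. if i = 1 then inv\<^bsub>Wplus n\<^esub> (Wplus_gen n 1)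
          else if i = 2 then (Wplus_gen n 1 [^]\<^bsub>Wplus n\<^esub> (2 :: nat)) \<otimes>\<^bsub>Wplus n\<^esub> Wplus_gen n 2
          else Wplus_gen n i)"

text \<open>
  For a group \<open>G\<close> with distinguished generators \<open>s 1, \<dots>, s (n - 1)\<close> satisfying the relations of \<open>W\<^sup>+\<close>,
  the normal subgroup \<open>M\<close> with \<open>G = W\<^sup>+ / M\<close>, generators corresponding.
\<close>

definition relation_subgroup :: "nat \<Rightarrow> ('h, 'm) monoid_scheme \<Rightarrow> (nat \<Rightarrow> 'h) \<Rightarrow> nat word set set" where
  "relation_subgroup n G s = kernel (Wplus n) G (induced_hom G s)"

definition polytope_relations :: "nat \<Rightarrow> 'a rel \<Rightarrow> 'a set \<Rightarrow> nat word set set" where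
  "polytope_relations n P \<Phi> = relation_subgroup n (rotation_group n P \<Phi>) (rotation P \<Phi>)"

text \<open>\<open>X(P)\<close>: the kernel of the natural map from \<open>W\<^sup>+ / M\<close> onto \<open>W\<^sup>+ / (M M')\<close>, with \<open>M'\<close> the image of \<open>M\<close> under \<^term>\<open>Wbar n\<close>.\<close>

definition chirality_group :: "nat \<Rightarrow> 'a rel \<Rightarrow> 'a set \<Rightarrow> nat word set set monoid" where
  "chirality_group n P \<Phi> =
     (let W = Wplus n; M = polytope_relations n P \<Phi>; MM = M <#>\<^bsub>W\<^esub> (Wbar n ` M)
      in (W Mod M) \<lparr>carrier := kernel (W Mod M) (W Mod MM) (\<lambda>A. A <#>\<^bsub>W\<^esub> MM)\<rparr>)"

definition mix_generator :: "'a rel \<Rightarrow> 'a set \<Rightarrow> 'b rel \<Rightarrow> 'b set \<Rightarrow> nat \<Rightarrow> ('a \<Rightarrow> 'a) \<times> ('b \<Rightarrow> 'b)" where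
  "mix_generator P \<Phi> Q \<Psi> i = (rotation P \<Phi> i, rotation Q \<Psi> i)"

definition mix_rotation_group ::
  "nat \<Rightarrow> 'a rel \<Rightarrow> 'a set \<Rightarrow> 'b rel \<Rightarrow> 'b set \<Rightarrow> (('a \<Rightarrow> 'a) \<times> ('b \<Rightarrow> 'b)) monoid" where
  "mix_rotation_group n P \<Phi> Q \<Psi> =
     subgroup_generated (rotation_group n P \<Phi> \<times>\<times> rotation_group n Q \<Psi>)
       (mix_generator P \<Phi> Q \<Psi> ` {1..<n})"

text \<open>
  The mix of \<open>P\<close> and \<open>Q\<close> (with base flags) need not be a polytope. It is given by its rotation
  group \<open>W\<^sup>+ / N\<close> with the distinguished generators, and is directly regular or chiral according to
  whether \<open>N\<close> is invariant under \<^term>\<open>Wbar n\<close>.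
\<close>

definition mix_relations :: "nat \<Rightarrow> 'a rel \<Rightarrow> 'a set \<Rightarrow> 'b rel \<Rightarrow> 'b set \<Rightarrow> nat word set set" where
  "mix_relations n P \<Phi> Q \<Psi> =
     relation_subgroup n (mix_rotation_group n P \<Phi> Q \<Psi>) (mix_generator P \<Phi> Q \<Psi>)"

definition mix_directly_regular :: "nat \<Rightarrow> 'a rel \<Rightarrow> 'a set \<Rightarrow> 'b rel \<Rightarrow> 'b set \<Rightarrow> bool" where
  "mix_directly_regular n P \<Phi> Q \<Psi> \<longleftrightarrow>
     Wbar n ` mix_relations n P \<Phi> Q \<Psi> = mix_relations n P \<Phi> Q \<Psi>"

definition mix_chiral :: "nat \<Rightarrow> 'a rel \<Rightarrow> 'a set \<Rightarrow> 'b rel \<Rightarrow> 'b set \<Rightarrow> bool" where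
  "mix_chiral n P \<Phi> Q \<Psi> \<longleftrightarrow> \<not> mix_directly_regular n P \<Phi> Q \<Psi>"

end

theory Submission
  imports Defs
begin

text \<open>
  Let \<open>P\<close> and \<open>Q\<close> belong to \<open>M\<close> and \<open>K\<close>, and suppose that the mix is directly regular, i.e. that
  \<open>N = M \<inter> K\<close> is invariant under the enantiomorphic automorphism \<open>b\<close> of \<open>W\<^sup>+\<close>. Then \<open>X(P)\<close> is the image of
  \<open>b M\<close> in \<open>W\<^sup>+ / M\<close>, and \<open>b m\<close> becomes trivial there as soon as \<open>m \<in> N\<close>. Hence \<open>X(P)\<close> is a quotient of
  \<open>M / N\<close>, which embeds into \<open>W\<^sup>+ / K\<close>, so that \<open>|X(P)|\<close> divides the order of the rotation group of
  \<open>Q\<close>; likewise with \<open>P\<close> and \<open>Q\<close> exchanged.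

  For this the standard rotations have to satisfy the relations of \<open>W\<^sup>+\<close>. As \<open>\<sigma>\<^sub>i\<close> takes the base flag
  to the \<open>i\<close>-adjacent flag of its \<open>(i - 1)\<close>-adjacent flag, and automorphisms preserve adjacency,
  \<open>\<sigma>\<^sub>i \<dots> \<sigma>\<^sub>j\<close> takes it to the \<open>j\<close>-adjacent flag of its \<open>(i - 1)\<close>-adjacent flag. These two adjacencies are
  commuting involutions for \<open>i < j\<close>, and an automorphism that fixes a flag is trivial.
\<close>

section \<open>Presented groups\<close>

definition word_class :: "'g set \<Rightarrow> 'g word set \<Rightarrow> 'g word \<Rightarrow> 'g word set" where
  "word_class S R u = {w. word_eq S R u w}"

lemma word_eq_lists:
  assumes "word_eq S R u v"
  shows "u \<in> lists (S \<times> UNIV) \<and> v \<in> lists (S \<times> UNIV)"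
  using assms by induction auto

text \<open>A word with a letter outside \<open>S\<close> is related to no word, so its class is
  empty. The assumption on \<open>u\<close> keeps two empty classes from being equal without
  \<open>word_eq\<close>.\<close>

lemma word_class_eq_iff:
  assumes "u \<in> lists (S \<times> UNIV)"
  shows "word_class S R u = word_class S R v \<longleftrightarrow> word_eq S R u v"
proof
  assume "word_class S R u = word_class S R v"
  then have "u \<in> word_class S R v"
    using assms by (auto simp: word_class_def intro: word_eq.refl)
  then show "word_eq S R u v" by (auto simp: word_class_def intro: word_eq.sym)
next
  assume "word_eq S R u v"
  then show "word_class S R u = word_class S R v"
    by (auto simp: word_class_def intro: word_eq.sym word_eq.trans)
qed

lemma carrier_presented_group:
  "carrier (presented_group S R) = word_class S R ` lists (S \<times> UNIV)"
  by (auto simp: presented_group_def word_class_def quotient_def)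

lemma word_class_in_carrier:
  "u \<in> lists (S \<times> UNIV) \<Longrightarrow> word_class S R u \<in> carrier (presented_group S R)"
  by (simp add: carrier_presented_group)

lemma presented_group_carrierE:
  assumes "A \<in> carrier (presented_group S R)"
  obtains u where "u \<in> lists (S \<times> UNIV)" "A = word_class S R u"
  using assms by (auto simp: carrier_presented_group)

lemma one_presented_group: "\<one>\<^bsub>presented_group S R\<^esub> = word_class S R []"
  by (simp add: presented_group_def word_class_def)

lemma mult_word_class:
  assumes "u \<in> lists (S \<times> UNIV)" "v \<in> lists (S \<times> UNIV)"
  shows "word_class S R u \<otimes>\<^bsub>presented_group S R\<^esub> word_class S R v = word_class S R (u @ v)"
proof -
  have "u \<in> word_class S R u" "v \<in> word_class S R v"
    using assms by (auto simp: word_class_def intro: word_eq.refl)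
  then show ?thesis
    by (auto simp: presented_group_def word_class_def intro: word_eq.append word_eq.trans word_eq.sym)
qed

section \<open>Inverse words and the group laws\<close>

fun inverse_word :: "'g word \<Rightarrow> 'g word" where
  "inverse_word [] = []"
| "inverse_word ((x, b) # w) = inverse_word w @ [(x, \<not> b)]"

lemma inverse_word_lists:
  "u \<in> lists (S \<times> UNIV) \<Longrightarrow> inverse_word u \<in> lists (S \<times> UNIV)"
  by (induction u rule: inverse_word.induct) auto

lemma word_eq_inverse_word:
  "u \<in> lists (S \<times> UNIV) \<Longrightarrow> word_eq S R (inverse_word u @ u) []"
proof (induction u rule: inverse_word.induct)
  case 1
  show ?case by (simp add: word_eq.refl)
next
  case (2 x b w)
  then have x: "x \<in> S" and w: "w \<in> lists (S \<times> UNIV)" by auto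
  \<comment> \<open>The two new letters meet in the middle of the word; cancelling them leaves the
    case of \<open>w\<close>.\<close>
  have "word_eq S R ([(x, \<not> b), (x, b)] @ w) ([] @ w)"
    using word_eq.cancel[OF x, of R "\<not> b"] w by (intro word_eq.append word_eq.refl) auto
  then have "word_eq S R (inverse_word w @ ([(x, \<not> b), (x, b)] @ w)) (inverse_word w @ w)"
    using w by (intro word_eq.append word_eq.refl inverse_word_lists) auto
  then show ?case using "2.IH" w by (auto intro: word_eq.trans)
qed

text \<open>\<open>groupI\<close> asks only for left inverses, which the inverted words provide.
  Associativity and the unit law come from concatenation of lists.\<close>

lemma group_presented_group: "group (presented_group S R)"
proof (rule groupI)
  fix x y assume "x \<in> carrier (presented_group S R)" "y \<in> carrier (presented_group S R)"
  then show "x \<otimes>\<^bsub>presented_group S R\<^esub> y \<in> carrier (presented_group S R)"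
    by (elim presented_group_carrierE) (simp add: mult_word_class word_class_in_carrier)
next
  show "\<one>\<^bsub>presented_group S R\<^esub> \<in> carrier (presented_group S R)"
    by (simp add: one_presented_group word_class_in_carrier)
next
  fix x y z
  assume "x \<in> carrier (presented_group S R)" "y \<in> carrier (presented_group S R)"
    "z \<in> carrier (presented_group S R)"
  then show "x \<otimes>\<^bsub>presented_group S R\<^esub> y \<otimes>\<^bsub>presented_group S R\<^esub> z =
      x \<otimes>\<^bsub>presented_group S R\<^esub> (y \<otimes>\<^bsub>presented_group S R\<^esub> z)"
    by (elim presented_group_carrierE) (simp add: mult_word_class)
next
  fix x assume "x \<in> carrier (presented_group S R)"
  then obtain u where u: "u \<in> lists (S \<times> UNIV)" "x = word_class S R u"
    by (rule presented_group_carrierE)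
  show "\<one>\<^bsub>presented_group S R\<^esub> \<otimes>\<^bsub>presented_group S R\<^esub> x = x"
    using u by (simp add: one_presented_group mult_word_class)
  show "\<exists>y\<in>carrier (presented_group S R). y \<otimes>\<^bsub>presented_group S R\<^esub> x = \<one>\<^bsub>presented_group S R\<^esub>"
  proof (rule bexI)
    show "word_class S R (inverse_word u) \<otimes>\<^bsub>presented_group S R\<^esub> x = \<one>\<^bsub>presented_group S R\<^esub>"
      using u word_eq_inverse_word[OF u(1)] inverse_word_lists[OF u(1)]
      by (simp add: one_presented_group mult_word_class word_class_eq_iff)
  qed (use u in \<open>simp add: word_class_in_carrier inverse_word_lists\<close>)
qed

section \<open>Evaluation of words and von Dyck's theorem\<close>

lemma word_value_Nil [simp]: "word_value G s [] = \<one>\<^bsub>G\<^esub>"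
  by (simp add: word_value_def)

lemma word_value_Cons [simp]:
  "word_value G s ((x, b) # w) = (if b then s x else inv\<^bsub>G\<^esub> (s x)) \<otimes>\<^bsub>G\<^esub> word_value G s w"
  by (simp add: word_value_def)

lemma word_value_cong:
  assumes "\<And>x. x \<in> S \<Longrightarrow> s x = t x" and "w \<in> lists (S \<times> UNIV)"
  shows "word_value G s w = word_value G t w"
  using assms(2) by (induction w) (auto simp: assms(1))

context group
begin

lemma word_value_closed:
  assumes "s ` S \<subseteq> carrier G" "w \<in> lists (S \<times> UNIV)"
  shows "word_value G s w \<in> carrier G"
  using assms(2,1) by (induction w) auto

lemma word_value_append:
  assumes s: "s ` S \<subseteq> carrier G" and "u \<in> lists (S \<times> UNIV)" and v: "v \<in> lists (S \<times> UNIV)"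
  shows "word_value G s (u @ v) = word_value G s u \<otimes> word_value G s v"
  using assms(2)
proof (induction u)
  case Nil
  show ?case using word_value_closed[OF s v] by simp
next
  case (Cons a u)
  then show ?case
    using s word_value_closed[OF s v] word_value_closed[OF s, of u]
    by (cases a) (auto simp: m_assoc image_subset_iff)
qed

text \<open>Each rule that generates the congruence preserves values. The condition on
  \<open>R\<close> is confined to relators over \<open>S\<close>, the ones that the congruence
  uses.\<close>

lemma word_value_eq:
  assumes s: "s ` S \<subseteq> carrier G"
    and R: "\<And>r. r \<in> R \<Longrightarrow> r \<in> lists (S \<times> UNIV) \<Longrightarrow> word_value G s r = \<one>"
    and "word_eq S R u v"
  shows "word_value G s u = word_value G s v"
  using assms(3)
proof induction
  case (append u u' v v')
  then show ?case
    using word_eq_lists[OF append.hyps(1)] word_eq_lists[OF append.hyps(2)]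
    by (simp add: word_value_append[OF s])
next
  case (cancel x b)
  then show ?case using s by (auto simp: image_subset_iff)
qed (use R in auto)

text \<open>All words of a class have one value, so the image of the class is a singleton and
  \<open>the_elem\<close> picks that value.\<close>

lemma induced_hom_word_class:
  assumes "s ` S \<subseteq> carrier G"
    and "\<And>r. r \<in> R \<Longrightarrow> r \<in> lists (S \<times> UNIV) \<Longrightarrow> word_value G s r = \<one>"
    and "u \<in> lists (S \<times> UNIV)"
  shows "induced_hom G s (word_class S R u) = word_value G s u"
proof -
  have "word_value G s ` word_class S R u = {word_value G s u}"
    using word_value_eq[OF assms(1,2)] word_eq.refl[OF assms(3)]
    by (force simp: word_class_def)
  then show ?thesis by (simp add: induced_hom_def)
qed

lemma induced_hom_hom:
  assumes "s ` S \<subseteq> carrier G"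
    and "\<And>r. r \<in> R \<Longrightarrow> r \<in> lists (S \<times> UNIV) \<Longrightarrow> word_value G s r = \<one>"
  shows "induced_hom G s \<in> hom (presented_group S R) G"
  by (rule homI; elim presented_group_carrierE)
    (simp_all add: mult_word_class induced_hom_word_class[OF assms] word_value_append[OF assms(1)]
      word_value_closed[OF assms(1)])

end

lemma (in group_hom) hom_word_value:
  assumes "s ` S \<subseteq> carrier G" "w \<in> lists (S \<times> UNIV)"
  shows "h (word_value G s w) = word_value H (h \<circ> s) w"
  using assms(2)
proof (induction w)
  case (Cons a w)
  then show ?case
    using assms(1) G.word_value_closed[OF assms(1), of w]
    by (cases a) (auto simp: image_subset_iff)
qed simp

text \<open>This translates between words modulo relators and products in the presented group. It
  rests on the class of an inverse letter being the inverse of the class of the letter.\<close>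

lemma word_value_word_class:
  assumes "w \<in> lists (S \<times> UNIV)"
  shows "word_value (presented_group S R) (\<lambda>x. word_class S R [(x, True)]) w = word_class S R w"
  using assms
proof (induction w)
  case Nil
  show ?case by (simp add: one_presented_group)
next
  case (Cons a w)
  obtain x b where a: "a = (x, b)" by fastforce
  interpret group "presented_group S R" by (rule group_presented_group)
  have x: "x \<in> S" "w \<in> lists (S \<times> UNIV)" using Cons.hyps by (auto simp: a)
  have "inv\<^bsub>presented_group S R\<^esub> (word_class S R [(x, True)]) = word_class S R [(x, False)]"
  proof (rule inv_equality)
    show "word_class S R [(x, False)] \<otimes>\<^bsub>presented_group S R\<^esub> word_class S R [(x, True)]
        = \<one>\<^bsub>presented_group S R\<^esub>"
      using x word_eq.cancel[OF x(1), of R False]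
      by (simp add: mult_word_class one_presented_group word_class_eq_iff)
  qed (use x in \<open>auto intro!: word_class_in_carrier\<close>)
  then show ?case
    using Cons.IH x by (cases b) (simp_all add: a mult_word_class)
qed


section \<open>The group \<open>W\<^sup>+\<close> and its enantiomorphic automorphism\<close>

abbreviation segment :: "nat \<Rightarrow> nat \<Rightarrow> nat word" where
  "segment i j \<equiv> map (\<lambda>k. (k, True)) [i..<Suc j]"

lemma segment_Cons: "i \<le> j \<Longrightarrow> segment i j = (i, True) # segment (Suc i) j"
  by (subst upt_conv_Cons) auto

lemma segment_lists: "1 \<le> i \<Longrightarrow> j < n \<Longrightarrow> segment i j \<in> lists ({1..<n} \<times> UNIV)"
  by auto

context group
begin

lemma Wplus_relators_value:
  assumes s: "s ` {1..<n} \<subseteq> carrier G"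
    and rel: "\<And>i j. 1 \<le> i \<Longrightarrow> i < j \<Longrightarrow> j < n \<Longrightarrow>
      word_value G s (segment i j) \<otimes> word_value G s (segment i j) = \<one>"
    and r: "r \<in> Wplus_relators n"
  shows "word_value G s r = \<one>"
proof -
  obtain i j where ij: "1 \<le> i" "i < j" "j < n" and r: "r = segment i j @ segment i j"
    using r by (auto simp: Wplus_relators_def)
  show ?thesis
    using rel[OF ij] ij segment_lists[of i j n] unfolding r
    by (subst word_value_append[OF s]) auto
qed

end

lemma group_Wplus: "group (Wplus n)"
  by (simp add: Wplus_def group_presented_group)

abbreviation Wplus_class :: "nat \<Rightarrow> nat word \<Rightarrow> nat word set" where
  "Wplus_class n \<equiv> word_class {1..<n} (Wplus_relators n)"

lemma Wplus_gen_eq: "Wplus_gen n i = Wplus_class n [(i, True)]"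
  by (simp add: Wplus_gen_def word_class_def)

lemma Wplus_gen_closed: "i \<in> {1..<n} \<Longrightarrow> Wplus_gen n i \<in> carrier (Wplus n)"
  by (simp add: Wplus_gen_eq Wplus_def word_class_in_carrier)

lemma word_value_Wplus_gen:
  "w \<in> lists ({1..<n} \<times> UNIV) \<Longrightarrow> word_value (Wplus n) (Wplus_gen n) w = Wplus_class n w"
  using word_value_word_class[of w "{1..<n}" "Wplus_relators n"]
  by (simp add: Wplus_def Wplus_gen_eq[abs_def])

lemma Wplus_segment_square:
  assumes "1 \<le> i" "i < j" "j < n"
  shows "word_value (Wplus n) (Wplus_gen n) (segment i j) \<otimes>\<^bsub>Wplus n\<^esub>
    word_value (Wplus n) (Wplus_gen n) (segment i j) = \<one>\<^bsub>Wplus n\<^esub>"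
proof -
  have l: "segment i j \<in> lists ({1..<n} \<times> UNIV)" using assms by (intro segment_lists) auto
  have "segment i j @ segment i j \<in> Wplus_relators n"
    using assms unfolding Wplus_relators_def by blast
  then have "word_eq {1..<n} (Wplus_relators n) (segment i j @ segment i j) []"
    by (rule word_eq.relator) (use l in auto)
  then show ?thesis
    using l unfolding word_value_Wplus_gen[OF l]
    by (simp only: Wplus_def mult_word_class one_presented_group)
      (subst word_class_eq_iff; simp)
qed

section \<open>The enantiomorphic automorphism is well defined and an involution\<close>

definition bar_gen :: "nat \<Rightarrow> nat \<Rightarrow> nat word set" where
  "bar_gen n i =
     (if i = 1 then inv\<^bsub>Wplus n\<^esub> (Wplus_gen n 1)
      else if i = 2 then (Wplus_gen n 1 [^]\<^bsub>Wplus n\<^esub> (2 :: nat)) \<otimes>\<^bsub>Wplus n\<^esub> Wplus_gen n 2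
      else Wplus_gen n i)"

lemma Wbar_eq: "Wbar n = induced_hom (Wplus n) (bar_gen n)"
  by (simp add: Wbar_def bar_gen_def[abs_def])

lemma bar_gen_closed: "bar_gen n ` {1..<n} \<subseteq> carrier (Wplus n)"
proof -
  interpret group "Wplus n" by (rule group_Wplus)
  show ?thesis by (auto simp: bar_gen_def Wplus_gen_closed)
qed

text \<open>Write \<open>p i j\<close> and \<open>q i j\<close> for the products of the old and the
  new generators from \<open>i\<close> to \<open>j\<close>, and \<open>a\<close> for
  \<open>\<sigma>\<^sub>1\<close>. The new generators give \<open>q 1 j = p 1 j\<close>, and
  \<open>q k j = p k j\<close> for \<open>k\<close> at least 3. Only \<open>q 2 j = a p 1 j\<close>
  is new, and its square is trivial because \<open>p 1 j\<close> and \<open>p 2 j\<close> both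
  square to one.\<close>

lemma bar_gen_relators:
  assumes "r \<in> Wplus_relators n"
  shows "word_value (Wplus n) (bar_gen n) r = \<one>\<^bsub>Wplus n\<^esub>"
proof -
  interpret W: group "Wplus n" by (rule group_Wplus)
  let ?p = "\<lambda>i j. word_value (Wplus n) (Wplus_gen n) (segment i j)"
  let ?q = "\<lambda>i j. word_value (Wplus n) (bar_gen n) (segment i j)"
  show ?thesis
  proof (rule W.Wplus_relators_value[OF bar_gen_closed _ assms])
    fix i j :: nat assume ij: "1 \<le> i" "i < j" "j < n"
    have gen: "Wplus_gen n ` {1..<n} \<subseteq> carrier (Wplus n)" by (auto simp: Wplus_gen_closed)
    have p_closed: "?p k j \<in> carrier (Wplus n)" if "1 \<le> k" for k
      using that ij by (intro W.word_value_closed[OF gen] segment_lists) auto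
    have high: "?q k j = ?p k j" if "3 \<le> k" for k
      using that ij by (intro word_value_cong[of "{3..<n}"]) (auto simp: bar_gen_def)
    define a where "a = Wplus_gen n 1"
    have a: "a \<in> carrier (Wplus n)" using ij by (auto simp: a_def intro!: Wplus_gen_closed)
    have p1: "?p 1 j = a \<otimes>\<^bsub>Wplus n\<^esub> ?p 2 j"
      using ij by (subst segment_Cons) (auto simp: a_def numeral_2_eq_2)
    \<comment> \<open>For \<open>j = 2\<close> the segment from 3 is empty and has value one, so
      this case is included.\<close>
    have p2: "?p 2 j = Wplus_gen n 2 \<otimes>\<^bsub>Wplus n\<^esub> ?p 3 j"
      using ij by (subst segment_Cons) (auto simp: numeral_2_eq_2 numeral_3_eq_3)
    have "?q 2 j = bar_gen n 2 \<otimes>\<^bsub>Wplus n\<^esub> ?q 3 j"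
      using ij by (subst segment_Cons) (auto simp: numeral_2_eq_2 numeral_3_eq_3)
    also have "\<dots> = (a [^]\<^bsub>Wplus n\<^esub> (2 :: nat)) \<otimes>\<^bsub>Wplus n\<^esub> ?p 2 j"
      using a p_closed[of 3] ij
      by (simp only: high p2) (simp add: bar_gen_def a_def W.m_assoc Wplus_gen_closed del: upt_Suc)
    also have "\<dots> = a \<otimes>\<^bsub>Wplus n\<^esub> ?p 1 j"
      unfolding p1 using a p_closed[of 2] by (simp add: numeral_2_eq_2 W.m_assoc del: upt_Suc)
    finally have q2: "?q 2 j = a \<otimes>\<^bsub>Wplus n\<^esub> ?p 1 j" .
    have "?q 1 j = bar_gen n 1 \<otimes>\<^bsub>Wplus n\<^esub> ?q 2 j"
      using ij by (subst segment_Cons) (auto simp: numeral_2_eq_2)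
    also have "\<dots> = ?p 1 j"
      using a p_closed[of 1] W.inv_solve_left[of "?p 1 j" a "?q 2 j"] unfolding q2
      by (simp add: bar_gen_def a_def W.m_assoc[symmetric] del: upt_Suc)
    finally have q1: "?q 1 j = ?p 1 j" .
    consider "i = 1" | "i = 2" | "3 \<le> i" using ij by linarith
    then show "?q i j \<otimes>\<^bsub>Wplus n\<^esub> ?q i j = \<one>\<^bsub>Wplus n\<^esub>"
    proof cases
      case 1
      then show ?thesis using Wplus_segment_square[OF ij] q1 by simp
    next
      case 3
      then show ?thesis using Wplus_segment_square[OF ij] high by simp
    next
      case 2
      define c where "c = ?p 2 j"
      have c: "c \<in> carrier (Wplus n)" using p_closed[of 2] by (simp add: c_def)
      have cc: "c \<otimes>\<^bsub>Wplus n\<^esub> c = \<one>\<^bsub>Wplus n\<^esub>"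
        using Wplus_segment_square[of 2 j n] ij 2 by (simp add: c_def)
      have ac: "(a \<otimes>\<^bsub>Wplus n\<^esub> c) \<otimes>\<^bsub>Wplus n\<^esub> (a \<otimes>\<^bsub>Wplus n\<^esub> c) = \<one>\<^bsub>Wplus n\<^esub>"
        using Wplus_segment_square[of 1 j n] ij p1 by (simp add: c_def)
      \<comment> \<open>From \<open>(a c)(a c) = 1\<close> the product \<open>a c a\<close> is the
        inverse of \<open>c\<close>, which is \<open>c\<close> itself. Hence
        \<open>(a a c)(a a c) = a (a c a)(a c) = (a c)(a c) = 1\<close>.\<close>
      have "a \<otimes>\<^bsub>Wplus n\<^esub> c \<otimes>\<^bsub>Wplus n\<^esub> a = c"
        using ac cc a c by (metis W.inv_equality W.m_assoc W.m_closed W.inv_inv)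
      moreover have "(a \<otimes>\<^bsub>Wplus n\<^esub> (a \<otimes>\<^bsub>Wplus n\<^esub> c)) \<otimes>\<^bsub>Wplus n\<^esub> (a \<otimes>\<^bsub>Wplus n\<^esub> (a \<otimes>\<^bsub>Wplus n\<^esub> c)) =
          a \<otimes>\<^bsub>Wplus n\<^esub> (a \<otimes>\<^bsub>Wplus n\<^esub> c \<otimes>\<^bsub>Wplus n\<^esub> a) \<otimes>\<^bsub>Wplus n\<^esub> (a \<otimes>\<^bsub>Wplus n\<^esub> c)"
        using a c by (simp add: W.m_assoc)
      ultimately have "(a \<otimes>\<^bsub>Wplus n\<^esub> (a \<otimes>\<^bsub>Wplus n\<^esub> c)) \<otimes>\<^bsub>Wplus n\<^esub> (a \<otimes>\<^bsub>Wplus n\<^esub> (a \<otimes>\<^bsub>Wplus n\<^esub> c)) = \<one>\<^bsub>Wplus n\<^esub>"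
        using ac by simp
      then show ?thesis unfolding 2 q2 p1 by (simp add: c_def)
    qed
  qed
qed

lemma Wbar_class:
  "w \<in> lists ({1..<n} \<times> UNIV) \<Longrightarrow> Wbar n (Wplus_class n w) = word_value (Wplus n) (bar_gen n) w"
  unfolding Wbar_eq
  by (rule group.induced_hom_word_class[OF group_Wplus bar_gen_closed bar_gen_relators])

lemma Wbar_hom: "Wbar n \<in> hom (Wplus n) (Wplus n)"
  using group.induced_hom_hom[OF group_Wplus bar_gen_closed bar_gen_relators]
  by (simp add: Wbar_eq Wplus_def)

lemma Wbar_gen: "i \<in> {1..<n} \<Longrightarrow> Wbar n (Wplus_gen n i) = bar_gen n i"
proof -
  assume i: "i \<in> {1..<n}"
  interpret group "Wplus n" by (rule group_Wplus)
  show ?thesis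
    using i bar_gen_closed[of n] Wbar_class[of "[(i, True)]" n]
    by (auto simp: Wplus_gen_eq image_subset_iff)
qed

text \<open>Both sides are homomorphisms in \<open>x\<close>, so it suffices to compare generators.
  The second one goes to \<open>\<sigma>\<^sub>1\<close> to the power -2 times
  \<open>\<sigma>\<^sub>1 \<sigma>\<^sub>1 \<sigma>\<^sub>2\<close>, which is
  \<open>\<sigma>\<^sub>2\<close>.\<close>

lemma Wbar_Wbar:
  assumes "x \<in> carrier (Wplus n)"
  shows "Wbar n (Wbar n x) = x"
proof -
  interpret group_hom "Wplus n" "Wplus n" "Wbar n"
    using Wbar_hom group_Wplus by (simp add: group_hom_def group_hom_axioms_def)
  obtain w where w: "w \<in> lists ({1..<n} \<times> UNIV)" and x: "x = Wplus_class n w"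
    using assms unfolding Wplus_def by (rule presented_group_carrierE)
  have bar2: "(Wbar n \<circ> bar_gen n) i = Wplus_gen n i" if i: "i \<in> {1..<n}" for i
  proof -
    have g: "Wplus_gen n k \<in> carrier (Wplus n)" if "1 \<le> k" "k \<le> i" for k
      using that i by (intro Wplus_gen_closed) auto
    consider "i = 1" | "i = 2" | "3 \<le> i" using i by force
    then show ?thesis
    proof cases
      case 1
      then show ?thesis using i g[of 1] by (simp add: bar_gen_def Wbar_gen)
    next
      case 2
      have n: "1 \<in> {1..<n}" "2 \<in> {1..<n}" using 2 i by auto
      have b: "bar_gen n 1 = inv\<^bsub>Wplus n\<^esub> Wplus_gen n 1" "bar_gen n 2 =
          (Wplus_gen n 1 [^]\<^bsub>Wplus n\<^esub> (2 :: nat)) \<otimes>\<^bsub>Wplus n\<^esub> Wplus_gen n 2"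
        by (auto simp: bar_gen_def)
      have "Wbar n (bar_gen n 2) = (inv\<^bsub>Wplus n\<^esub> Wplus_gen n 1 [^]\<^bsub>Wplus n\<^esub> (2 :: nat)) \<otimes>\<^bsub>Wplus n\<^esub>
          ((Wplus_gen n 1 [^]\<^bsub>Wplus n\<^esub> (2 :: nat)) \<otimes>\<^bsub>Wplus n\<^esub> Wplus_gen n 2)"
        using g[of 1] g[of 2] 2 unfolding b(2)
        by (simp add: hom_nat_pow Wbar_gen[OF n(1)] Wbar_gen[OF n(2)] b del: One_nat_def)
      also have "\<dots> = Wplus_gen n 2"
        using g[of 1] g[of 2] 2 by (simp add: G.nat_pow_inv G.m_assoc[symmetric])
      finally show ?thesis using 2 by simp
    next
      case 3
      then show ?thesis using i by (simp add: bar_gen_def Wbar_gen)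
    qed
  qed
  have "Wbar n (Wbar n x) = word_value (Wplus n) (Wbar n \<circ> bar_gen n) w"
    unfolding x Wbar_class[OF w] using bar_gen_closed w by (rule hom_word_value)
  also have "\<dots> = word_value (Wplus n) (Wplus_gen n) w"
    using bar2 w by (rule word_value_cong)
  finally show ?thesis using w by (simp add: x word_value_Wplus_gen)
qed


section \<open>Flags and automorphisms of polytopes\<close>

locale finite_polytope =
  fixes n :: nat and P :: "'a rel"
  assumes finite_faces: "finite (Field P)" and polytope: "abstract_polytope n P"
begin

lemma order_refl: "F \<in> Field P \<Longrightarrow> (F, F) \<in> P"
  and order_trans: "(F, G) \<in> P \<Longrightarrow> (G, H) \<in> P \<Longrightarrow> (F, H) \<in> P"
  and order_antisym: "(F, G) \<in> P \<Longrightarrow> (G, F) \<in> P \<Longrightarrow> F = G"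
  using polytope
  by (auto simp: abstract_polytope_def partial_order_on_def preorder_on_def
      dest: refl_onD transD antisymD)

lemma chain_faces: "C \<in> Chains P \<Longrightarrow> C \<subseteq> Field P"
  by (auto simp: Chains_def Field_def)

lemma flag_chain: "\<Phi> \<in> flags P \<Longrightarrow> \<Phi> \<in> Chains P"
  by (simp add: flags_def)

lemma flag_faces: "\<Phi> \<in> flags P \<Longrightarrow> \<Phi> \<subseteq> Field P"
  by (simp add: flag_chain chain_faces)

lemma flag_finite: "\<Phi> \<in> flags P \<Longrightarrow> finite \<Phi>"
  using flag_faces finite_faces by (rule finite_subset)

lemma flag_card: "\<Phi> \<in> flags P \<Longrightarrow> card \<Phi> = n + 2"
  using polytope by (auto simp: abstract_polytope_def)

lemma flag_total: "\<Phi> \<in> flags P \<Longrightarrow> F \<in> \<Phi> \<Longrightarrow> G \<in> \<Phi> \<Longrightarrow> (F, G) \<in> P \<or> (G, F) \<in> P"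
  using flag_chain by (auto simp: Chains_def)

text \<open>The face set is finite, hence so is the set of chains, and some maximal chain contains
  \<open>C\<close>.\<close>

lemma chain_extends_to_flag:
  assumes "C \<in> Chains P"
  obtains \<Phi> where "\<Phi> \<in> flags P" "C \<subseteq> \<Phi>"
proof -
  have "finite (Chains P)"
    using finite_faces chain_faces by (auto intro: finite_subset[of _ "Pow (Field P)"])
  then obtain \<Phi> where "\<Phi> \<in> Chains P" "C \<subseteq> \<Phi>" "\<forall>D\<in>Chains P. \<Phi> \<subseteq> D \<longrightarrow> \<Phi> = D"
    using finite_has_maximal2[OF _ assms] by blast
  then have "\<Phi> \<in> flags P" unfolding flags_def by blast
  then show ?thesis using \<open>C \<subseteq> \<Phi>\<close> by (rule that)
qed

text \<open>A flag around \<open>C\<close> has equally many faces and so equals \<open>C\<close>.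
  All new flags below are recognised by this count.\<close>

lemma chain_card_flag:
  assumes "C \<in> Chains P" "card C = n + 2"
  shows "C \<in> flags P"
proof -
  obtain \<Phi> where "\<Phi> \<in> flags P" "C \<subseteq> \<Phi>" using assms(1) by (rule chain_extends_to_flag)
  then show ?thesis using assms(2) card_subset_eq[of \<Phi> C] flag_finite flag_card by metis
qed

lemma face_in_flag:
  assumes "F \<in> Field P"
  shows "\<exists>\<Phi>\<in>flags P. F \<in> \<Phi>"
proof -
  have "{F} \<in> Chains P" using assms order_refl by (simp add: Chains_def)
  then obtain \<Phi> where "\<Phi> \<in> flags P" "{F} \<subseteq> \<Phi>" by (rule chain_extends_to_flag)
  then show ?thesis by auto
qed

lemma comparable_in_flag:
  assumes "\<Phi> \<in> flags P" "F \<in> Field P" "\<And>G. G \<in> \<Phi> \<Longrightarrow> (F, G) \<in> P \<or> (G, F) \<in> P"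
  shows "F \<in> \<Phi>"
proof -
  have "insert F \<Phi> \<in> Chains P"
    using assms order_refl flag_total[OF assms(1)] by (auto simp: Chains_def)
  then have "insert F \<Phi> = \<Phi>" using assms(1) unfolding flags_def by blast
  then show ?thesis by blast
qed


subsection \<open>Ranks\<close>

definition below :: "'a set \<Rightarrow> 'a \<Rightarrow> 'a set" where
  "below \<Phi> F = {G \<in> \<Phi>. (G, F) \<in> P \<and> G \<noteq> F}"

text \<open>The faces of \<open>\<Phi>\<close> below \<open>F\<close> and those of \<open>\<Psi>\<close> not below \<open>F\<close> together form a chain.\<close>

lemma card_below_le:
  assumes "\<Phi> \<in> flags P" "\<Psi> \<in> flags P" "F \<in> \<Phi>" "F \<in> \<Psi>"
  shows "card (below \<Phi> F) \<le> card (below \<Psi> F)"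
proof -
  define U where "U = \<Psi> - below \<Psi> F"
  have U: "(F, G) \<in> P" if "G \<in> U" for G
    using that flag_total[OF assms(2,4), of G] flag_faces[OF assms(2)] order_refl
    by (auto simp: U_def below_def)
  have disj: "below \<Phi> F \<inter> U = {}"
    using U order_antisym by (auto simp: below_def)
  have "(H, G) \<in> P" if "H \<in> below \<Phi> F" "G \<in> U" for H G
    using that U by (auto simp: below_def intro: order_trans)
  then have "below \<Phi> F \<union> U \<in> Chains P"
    using flag_total[OF assms(1)] flag_total[OF assms(2)]
    by (fastforce simp: Chains_def below_def U_def)
  then obtain \<Theta> where \<Theta>: "\<Theta> \<in> flags P" "below \<Phi> F \<union> U \<subseteq> \<Theta>"
    by (rule chain_extends_to_flag)
  have fin: "finite (below \<Phi> F)" "finite U" "finite (below \<Psi> F)"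
    using flag_finite assms by (auto simp: below_def U_def)
  have "card (below \<Phi> F) + card U = card (below \<Phi> F \<union> U)"
    using fin disj by (simp add: card_Un_disjoint)
  \<comment> \<open>The chain and \<Psi> share \<open>U\<close> and differ only in the part below
    \<open>F\<close>; \<Psi> has the largest size that a chain can have.\<close>
  also have "\<dots> \<le> n + 2"
    using \<Theta> flag_card flag_finite card_mono by metis
  also have "n + 2 = card (below \<Psi> F) + card U"
  proof -
    have "\<Psi> = below \<Psi> F \<union> U" "below \<Psi> F \<inter> U = {}" by (auto simp: U_def below_def)
    then show ?thesis using fin card_Un_disjoint flag_card[OF assms(2)] by metis
  qed
  finally show ?thesis by simp
qed

text \<open>The choice of flag is harmless, since \<open>card_below_le\<close> applies in both
  directions. Subtracting 1 gives a least face rank -1.\<close>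

definition rk :: "'a \<Rightarrow> int" where
  "rk F = int (card (below (SOME \<Phi>. \<Phi> \<in> flags P \<and> F \<in> \<Phi>) F)) - 1"

lemma card_below:
  assumes "\<Phi> \<in> flags P" "F \<in> \<Phi>"
  shows "int (card (below \<Phi> F)) = rk F + 1"
proof -
  define \<Psi> where "\<Psi> = (SOME \<Phi>. \<Phi> \<in> flags P \<and> F \<in> \<Phi>)"
  have "\<Psi> \<in> flags P \<and> F \<in> \<Psi>"
    unfolding \<Psi>_def using assms by (intro someI[where P = "\<lambda>\<Phi>. \<Phi> \<in> flags P \<and> F \<in> \<Phi>"]) simp
  then have "card (below \<Phi> F) = card (below \<Psi> F)"
    using card_below_le assms by (metis order.antisym)
  then show ?thesis by (simp add: rk_def \<Psi>_def)
qed

lemma has_rank_iff: "has_rank P F i \<longleftrightarrow> F \<in> Field P \<and> rk F = i"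
proof
  assume "has_rank P F i"
  then obtain \<Phi> where "\<Phi> \<in> flags P" "F \<in> \<Phi>" "int (card (below \<Phi> F)) = i + 1"
    by (auto simp: has_rank_def below_def)
  then show "F \<in> Field P \<and> rk F = i" using card_below flag_faces by fastforce
next
  assume F: "F \<in> Field P \<and> rk F = i"
  then obtain \<Phi> where "\<Phi> \<in> flags P" "F \<in> \<Phi>" using face_in_flag by blast
  then show "has_rank P F i"
    using card_below F unfolding has_rank_def below_def by blast
qed

lemma rk_strict_mono:
  assumes "(F, G) \<in> P" "F \<noteq> G"
  shows "rk F < rk G"
proof -
  have "{F, G} \<in> Chains P"
    using assms order_refl by (auto simp: Chains_def Field_def)
  then obtain \<Phi> where "\<Phi> \<in> flags P" "{F, G} \<subseteq> \<Phi>" by (rule chain_extends_to_flag)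
  then have \<Phi>: "\<Phi> \<in> flags P" "F \<in> \<Phi>" "G \<in> \<Phi>" by auto
  have "below \<Phi> F \<subset> below \<Phi> G"
    using assms \<Phi> order_trans order_antisym by (auto simp: below_def)
  then have "card (below \<Phi> F) < card (below \<Phi> G)"
    using flag_finite[OF \<Phi>(1)] by (intro psubset_card_mono) (auto simp: below_def)
  then show ?thesis using card_below[OF \<Phi>(1,2)] card_below[OF \<Phi>(1,3)] by simp
qed

lemma flag_le_iff:
  assumes "\<Phi> \<in> flags P" "F \<in> \<Phi>" "G \<in> \<Phi>"
  shows "(F, G) \<in> P \<longleftrightarrow> rk F \<le> rk G"
  using flag_total[OF assms] rk_strict_mono[of F G] rk_strict_mono[of G F] by force

lemma flag_rk_eq: "\<Phi> \<in> flags P \<Longrightarrow> F \<in> \<Phi> \<Longrightarrow> G \<in> \<Phi> \<Longrightarrow> rk F = rk G \<Longrightarrow> F = G"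
  using flag_le_iff order_antisym by fastforce

text \<open>\<open>rk\<close> is injective on a flag, whose \<open>n + 2\<close> faces are as many
  as the integers from -1 to \<open>n\<close>.\<close>

lemma flag_rk_image:
  assumes \<Phi>: "\<Phi> \<in> flags P"
  shows "rk ` \<Phi> = {-1..int n}"
proof (rule card_subset_eq)
  show "rk ` \<Phi> \<subseteq> {-1..int n}"
  proof clarify
    fix F assume F: "F \<in> \<Phi>"
    have "below \<Phi> F \<subset> \<Phi>" using F by (auto simp: below_def)
    then have "card (below \<Phi> F) < n + 2"
      using flag_card[OF \<Phi>] flag_finite[OF \<Phi>] psubset_card_mono by metis
    then show "rk F \<in> {-1..int n}" using card_below[OF \<Phi> F] by simp
  qed
  have "inj_on rk \<Phi>" using flag_rk_eq[OF \<Phi>] by (auto intro: inj_onI)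
  then show "card (rk ` \<Phi>) = card {-1..int n}" by (simp add: card_image flag_card[OF \<Phi>])
qed simp

lemma flag_face_ex:
  assumes "\<Phi> \<in> flags P" "-1 \<le> i" "i \<le> int n"
  shows "\<exists>F\<in>\<Phi>. rk F = i"
  using flag_rk_image[OF assms(1)] assms(2,3) by (metis atLeastAtMost_iff imageE)

lemma rk_range: "F \<in> Field P \<Longrightarrow> -1 \<le> rk F \<and> rk F \<le> int n"
  using face_in_flag flag_rk_image by (metis atLeastAtMost_iff imageI)

text \<open>The least face \<open>L\<close> and the greatest face \<open>T\<close> are comparable
  with every face, hence lie in every flag. Any other face has rank strictly between theirs, which
  excludes the extreme ranks.\<close>

lemma least_and_greatest_in_flags:
  assumes "F \<in> Field P" "rk F = -1 \<or> rk F = int n" "\<Phi> \<in> flags P"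
  shows "F \<in> \<Phi>"
proof -
  obtain L where L: "L \<in> Field P" "\<forall>G\<in>Field P. (L, G) \<in> P"
    using polytope by (auto simp: abstract_polytope_def)
  obtain T where T: "T \<in> Field P" "\<forall>G\<in>Field P. (G, T) \<in> P"
    using polytope by (auto simp: abstract_polytope_def)
  have "F = L \<or> F = T"
  proof (rule ccontr)
    assume "\<not> ?thesis"
    then have "rk L < rk F" "rk F < rk T" using L T assms(1) rk_strict_mono by auto
    then show False using assms(2) rk_range[OF L(1)] rk_range[OF T(1)] by linarith
  qed
  moreover have "L \<in> \<Phi>" "T \<in> \<Phi>"
    using L T flag_faces[OF assms(3)] by (auto intro!: comparable_in_flag[OF assms(3)])
  ultimately show ?thesis by auto
qed


subsection \<open>Adjacent flags\<close>

text \<open>Flags have equal size, so the two differences do too, and a flag has only one face of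
  rank \<open>i\<close>. Adjacency thereby reduces to a one-sided inclusion away from rank
  \<open>i\<close>.\<close>

lemma i_adjacent_iff:
  "i_adjacent P i \<Phi> \<Psi> \<longleftrightarrow>
    \<Phi> \<in> flags P \<and> \<Psi> \<in> flags P \<and> \<Phi> \<noteq> \<Psi> \<and> (\<forall>F\<in>\<Phi>. rk F \<noteq> int i \<longrightarrow> F \<in> \<Psi>)"
  (is "?L \<longleftrightarrow> ?R")
proof
  assume ?L
  then show ?R by (auto simp: i_adjacent_def adjacent_def has_rank_iff)
next
  assume R: ?R
  then have fl: "\<Phi> \<in> flags P" "\<Psi> \<in> flags P" by auto
  have eq: "card (\<Phi> - \<Psi>) = card (\<Psi> - \<Phi>)"
    using card_Diff_subset_Int[of \<Phi> \<Psi>] card_Diff_subset_Int[of \<Psi> \<Phi>] fl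
    by (simp add: flag_finite flag_card Int_commute)
  have ne: "\<Phi> - \<Psi> \<noteq> {}"
    using R fl card_subset_eq[of \<Psi> \<Phi>] by (auto simp: flag_finite flag_card)
  then obtain F where F: "F \<in> \<Phi> - \<Psi>" by blast
  have "G = F" if "G \<in> \<Phi> - \<Psi>" for G
  proof (rule flag_rk_eq[OF fl(1)])
    show "rk G = rk F" using that F R by (metis DiffD1 DiffD2)
  qed (use that F in auto)
  then have "\<Phi> - \<Psi> = {F}" using F by blast
  then have "card (\<Phi> - \<Psi>) = 1" by simp
  moreover have "\<forall>F\<in>\<Phi> - \<Psi>. has_rank P F (int i)"
    using R fl flag_faces by (auto simp: has_rank_iff)
  ultimately show ?L using eq fl by (simp add: i_adjacent_def adjacent_def)
qed

lemma i_adjacent_sym: "i_adjacent P i \<Phi> \<Psi> \<Longrightarrow> i_adjacent P i \<Psi> \<Phi>"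
proof -
  assume adj: "i_adjacent P i \<Phi> \<Psi>"
  then have fl: "\<Phi> \<in> flags P" "\<Psi> \<in> flags P" by (auto simp: i_adjacent_iff)
  have "F \<in> \<Phi>" if F: "F \<in> \<Psi>" "rk F \<noteq> int i" for F
  proof -
    have "F \<in> Field P" using F fl flag_faces by auto
    then obtain G where G: "G \<in> \<Phi>" "rk G = rk F"
      using flag_face_ex[OF fl(1)] rk_range by metis
    then have "G \<in> \<Psi>" using adj F by (auto simp: i_adjacent_iff)
    then show ?thesis using G F flag_rk_eq[OF fl(2)] by metis
  qed
  moreover have "\<Psi> \<noteq> \<Phi>" using adj by (auto simp: i_adjacent_iff)
  ultimately show ?thesis using fl by (simp add: i_adjacent_iff)
qed

text \<open>The index is the rank of the only face of \<Phi> missing from \<Psi>. It is neither -1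
  nor \<open>n\<close>, as faces of these ranks lie in every flag.\<close>

lemma adjacent_imp_i_adjacent:
  assumes "adjacent P \<Phi> \<Psi>"
  obtains i where "i < n" "i_adjacent P i \<Phi> \<Psi>"
proof -
  have fl: "\<Phi> \<in> flags P" "\<Psi> \<in> flags P" using assms by (auto simp: adjacent_def)
  obtain F where F: "\<Phi> - \<Psi> = {F}"
    using assms by (auto simp: adjacent_def card_1_singleton_iff)
  then have "F \<in> Field P" using flag_faces[OF fl(1)] by auto
  then have "rk F \<noteq> -1 \<and> rk F \<noteq> int n" "-1 \<le> rk F \<and> rk F \<le> int n"
    using F least_and_greatest_in_flags[OF _ _ fl(2)] rk_range by auto
  then have r: "int (nat (rk F)) = rk F" "nat (rk F) < n" by auto
  have "i_adjacent P (nat (rk F)) \<Phi> \<Psi>"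
    using fl F r by (auto simp: i_adjacent_iff)
  then show ?thesis using r(2) that by blast
qed

section \<open>The diamond condition: unique adjacent flags and their commutation\<close>

definition between :: "'a \<Rightarrow> 'a \<Rightarrow> 'a set" where
  "between F G = {H. (F, H) \<in> P \<and> (H, G) \<in> P \<and> H \<noteq> F \<and> H \<noteq> G}"

lemma card_between:
  assumes "(F, G) \<in> P" "rk G = rk F + 2"
  shows "card (between F G) = 2"
proof -
  have "F \<in> Field P" "G \<in> Field P" using assms(1) by (auto simp: Field_def)
  then have "has_rank P F ((rk F + 1) - 1) \<and> has_rank P G ((rk F + 1) + 1)"
    using assms by (simp add: has_rank_iff)
  then show ?thesis
    using polytope assms(1) unfolding abstract_polytope_def diamond_condition_def between_def by blast
qed

lemma rk_between:
  assumes "H \<in> between F G" "rk G = rk F + 2"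
  shows "rk H = rk F + 1"
  using assms rk_strict_mono[of F H] rk_strict_mono[of H G] by (auto simp: between_def)

lemma flag_between:
  assumes "\<Phi> \<in> flags P" "F \<in> \<Phi>" "G \<in> \<Phi>" "H \<in> \<Phi>" "rk F < rk H" "rk H < rk G"
  shows "H \<in> between F G"
  using assms flag_le_iff[OF assms(1)] by (auto simp: between_def)

text \<open>The remaining faces of the flag lie below \<open>F\<close> or above \<open>G\<close>, so
  all are comparable with \<open>H\<close>. One face is removed and one is added, so the size is
  again that of a flag.\<close>

lemma replace_face:
  assumes \<Phi>: "\<Phi> \<in> flags P" and F: "F \<in> \<Phi>" and G: "G \<in> \<Phi>"
    and H: "H \<in> between F G" and rk: "rk G = rk F + 2"
  shows "insert H {K \<in> \<Phi>. rk K \<noteq> rk F + 1} \<in> flags P" (is "?\<Psi> \<in> _")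
proof (rule chain_card_flag)
  have HP: "(F, H) \<in> P" "(H, G) \<in> P" "rk H = rk F + 1"
    using H rk_between[OF H rk] by (auto simp: between_def)
  then have "H \<in> Field P" by (auto simp: Field_def)
  have cmp: "(K, H) \<in> P \<or> (H, K) \<in> P" if "K \<in> \<Phi>" "rk K \<noteq> rk F + 1" for K
  proof (cases "rk K \<le> rk F")
    case True
    then have "(K, F) \<in> P" using flag_le_iff[OF \<Phi> that(1) F] by simp
    then show ?thesis using HP order_trans by blast
  next
    case False
    then have "(G, K) \<in> P" using flag_le_iff[OF \<Phi> G that(1)] rk that(2) by simp
    then show ?thesis using HP order_trans by blast
  qed
  then show "?\<Psi> \<in> Chains P"
    using flag_total[OF \<Phi>] order_refl[OF \<open>H \<in> Field P\<close>] by (auto simp: Chains_def)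
  have "F \<in> Field P" "G \<in> Field P" using flag_faces[OF \<Phi>] F G by auto
  then have "-1 \<le> rk F + 1" "rk F + 1 \<le> int n" using rk_range[of F] rk_range[of G] rk by auto
  then obtain H0 where H0: "H0 \<in> \<Phi>" "rk H0 = rk F + 1" using flag_face_ex[OF \<Phi>, of "rk F + 1"] by blast
  have "{K \<in> \<Phi>. rk K \<noteq> rk F + 1} = \<Phi> - {H0}"
    using H0 by (auto dest: flag_rk_eq[OF \<Phi> _ H0(1)])
  then have "card {K \<in> \<Phi>. rk K \<noteq> rk F + 1} = n + 1"
    using H0 flag_card[OF \<Phi>] flag_finite[OF \<Phi>] by simp
  moreover have "H \<notin> {K \<in> \<Phi>. rk K \<noteq> rk F + 1}" using HP by simp
  ultimately show "card ?\<Psi> = n + 2" using flag_finite[OF \<Phi>] by simp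
qed

lemma flag_neighboursE:
  assumes \<Phi>: "\<Phi> \<in> flags P" and "i < n"
  obtains F G where "F \<in> \<Phi>" "G \<in> \<Phi>" "rk F = int i - 1" "rk G = rk F + 2" "card (between F G) = 2"
proof -
  obtain F where F: "F \<in> \<Phi>" "rk F = int i - 1" using flag_face_ex[OF \<Phi>, of "int i - 1"] assms by auto
  obtain G where G: "G \<in> \<Phi>" "rk G = int i + 1" using flag_face_ex[OF \<Phi>, of "int i + 1"] assms by auto
  have "(F, G) \<in> P" using flag_le_iff[OF \<Phi> F(1) G(1)] F G by simp
  then show ?thesis using that F G card_between[of F G] by simp
qed

text \<open>The diamond condition leaves exactly one face \<open>H'\<close> besides \<open>H\<close>
  between the neighbours \<open>F\<close> and \<open>G\<close>. Exchanging \<open>H\<close> for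
  \<open>H'\<close> gives an adjacent flag. In any other adjacent flag the face of rank
  \<open>i\<close> also lies between \<open>F\<close> and \<open>G\<close> and is not
  \<open>H\<close>, so it is \<open>H'\<close>.\<close>

lemma i_adjacent_ex1:
  assumes \<Phi>: "\<Phi> \<in> flags P" and i: "i < n"
  shows "\<exists>!\<Psi>. i_adjacent P i \<Phi> \<Psi>"
proof -
  obtain F G where FG: "F \<in> \<Phi>" "G \<in> \<Phi>" "rk F = int i - 1" "rk G = rk F + 2"
    "card (between F G) = 2"
    using \<Phi> i by (rule flag_neighboursE)
  obtain H where H: "H \<in> \<Phi>" "rk H = int i" using flag_face_ex[OF \<Phi>, of "int i"] i by auto
  have "H \<in> between F G" using flag_between[OF \<Phi> FG(1,2) H(1)] FG H by simp
  then obtain H' where H': "between F G = {H, H'}" "H' \<noteq> H"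
    using FG(5) by (metis card_2_iff doubleton_eq_iff insert_iff singletonD)
  have "H' \<in> between F G" using H' by simp
  let ?\<Psi> = "insert H' {K \<in> \<Phi>. rk K \<noteq> rk F + 1}"
  have \<Psi>: "?\<Psi> \<in> flags P" using replace_face[OF \<Phi> FG(1,2) \<open>H' \<in> _\<close> FG(4)] .
  have "H \<notin> ?\<Psi>" using H H' FG by auto
  then have "i_adjacent P i \<Phi> ?\<Psi>" using \<Phi> \<Psi> H FG by (auto simp: i_adjacent_iff)
  moreover have "\<Theta> = ?\<Psi>" if adj: "i_adjacent P i \<Phi> \<Theta>" for \<Theta>
  proof -
    have \<Theta>: "\<Theta> \<in> flags P" "\<Phi> \<noteq> \<Theta>" "\<forall>K\<in>\<Phi>. rk K \<noteq> int i \<longrightarrow> K \<in> \<Theta>"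
      using adj by (auto simp: i_adjacent_iff)
    obtain K where K: "K \<in> \<Theta>" "rk K = int i" using flag_face_ex[OF \<Theta>(1), of "int i"] i by auto
    have "F \<in> \<Theta>" "G \<in> \<Theta>" using \<Theta>(3) FG by auto
    then have "K \<in> between F G" using flag_between[OF \<Theta>(1) _ _ K(1)] FG K by simp
    moreover have "K \<noteq> H"
    proof
      assume "K = H"
      then have "\<Phi> \<subseteq> \<Theta>" using \<Theta>(3) K H flag_rk_eq[OF \<Phi> _ H(1)] by (metis subsetI)
      then show False
        using \<Theta>(2) card_subset_eq[OF flag_finite[OF \<Theta>(1)]] flag_card \<Phi> \<Theta>(1) by metis
    qed
    ultimately have "K = H'" using H' by auto
    then have "?\<Psi> \<subseteq> \<Theta>" using \<Theta>(3) K FG by auto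
    then show ?thesis
      using card_subset_eq[OF flag_finite[OF \<Theta>(1)]] flag_card \<Psi> \<Theta>(1) by metis
  qed
  ultimately show ?thesis by blast
qed

definition adj :: "nat \<Rightarrow> 'a set \<Rightarrow> 'a set" where
  "adj i \<Phi> = (THE \<Psi>. i_adjacent P i \<Phi> \<Psi>)"

lemma i_adjacent_iff_adj:
  assumes "\<Phi> \<in> flags P" "i < n"
  shows "i_adjacent P i \<Phi> \<Psi> \<longleftrightarrow> \<Psi> = adj i \<Phi>"
  using theI'[OF i_adjacent_ex1[OF assms]] i_adjacent_ex1[OF assms] unfolding adj_def by blast

lemma i_adjacent_adj: "\<Phi> \<in> flags P \<Longrightarrow> i < n \<Longrightarrow> i_adjacent P i \<Phi> (adj i \<Phi>)"
  by (simp add: i_adjacent_iff_adj)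

lemma adj_flag: "\<Phi> \<in> flags P \<Longrightarrow> i < n \<Longrightarrow> adj i \<Phi> \<in> flags P"
  using i_adjacent_adj by (auto simp: i_adjacent_iff)

lemma adj_adj: "\<Phi> \<in> flags P \<Longrightarrow> i < n \<Longrightarrow> adj i (adj i \<Phi>) = \<Phi>"
  using i_adjacent_sym[OF i_adjacent_adj] i_adjacent_iff_adj adj_flag by metis

text \<open>The neighbours \<open>F\<close> and \<open>G\<close> of rank \<open>j - 1\<close> and
  \<open>j + 1\<close> survive the change at rank \<open>i\<close>. So the new face \<open>H\<close>
  of rank \<open>j\<close> fits into \<open>adj i \<Phi>\<close> as well, and the resulting flag is
  \<open>j\<close>-adjacent to \<open>adj i \<Phi>\<close> and \<open>i\<close>-adjacent to
  \<open>adj j \<Phi>\<close>.\<close>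

lemma adj_commute:
  assumes \<Phi>: "\<Phi> \<in> flags P" and ij: "i < n" "j < n" "i \<noteq> j" "i \<noteq> Suc j" "j \<noteq> Suc i"
  shows "adj i (adj j \<Phi>) = adj j (adj i \<Phi>)"
proof -
  define A where "A = adj i \<Phi>"
  define C where "C = adj j \<Phi>"
  have A: "A \<in> flags P" "A \<noteq> \<Phi>" "\<And>K. K \<in> \<Phi> \<Longrightarrow> rk K \<noteq> int i \<Longrightarrow> K \<in> A"
    using i_adjacent_adj[OF \<Phi> ij(1)] by (auto simp: A_def i_adjacent_iff)
  have C: "C \<in> flags P" "C \<noteq> \<Phi>" "\<And>K. K \<in> \<Phi> \<Longrightarrow> rk K \<noteq> int j \<Longrightarrow> K \<in> C"
    "\<And>K. K \<in> C \<Longrightarrow> rk K \<noteq> int j \<Longrightarrow> K \<in> \<Phi>"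
    using i_adjacent_adj[OF \<Phi> ij(2)] i_adjacent_sym[OF i_adjacent_adj[OF \<Phi> ij(2)]]
    by (auto simp: C_def i_adjacent_iff)
  obtain F G where FG: "F \<in> \<Phi>" "G \<in> \<Phi>" "rk F = int j - 1" "rk G = rk F + 2"
    using flag_neighboursE[OF \<Phi> ij(2)] by metis
  have FGA: "F \<in> A" "G \<in> A" and FGC: "F \<in> C" "G \<in> C" using A(3) C(3) FG ij by auto
  obtain H where H: "H \<in> C" "rk H = int j" using flag_face_ex[OF C(1), of "int j"] ij by auto
  have between: "H \<in> between F G" using flag_between[OF C(1) FGC H(1)] FG H by simp
  let ?\<Omega> = "insert H {K \<in> A. rk K \<noteq> rk F + 1}"
  have \<Omega>: "?\<Omega> \<in> flags P" using replace_face[OF A(1) FGA between FG(4)] .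
  have "H \<notin> A"
  proof
    assume "H \<in> A"
    obtain H0 where H0: "H0 \<in> \<Phi>" "rk H0 = int j" using flag_face_ex[OF \<Phi>, of "int j"] ij by auto
    then have "H0 \<in> A" using A(3) ij by auto
    then have "H = H0" using \<open>H \<in> A\<close> H H0 flag_rk_eq[OF A(1), of H H0] by simp
    then have "C \<subseteq> \<Phi>" using C(4) H H0 flag_rk_eq[OF C(1) _ H(1)] by (metis subsetI)
    then show False using C card_subset_eq[OF flag_finite[OF \<Phi>]] flag_card \<Phi> by metis
  qed
  then have "i_adjacent P j A ?\<Omega>" using A(1) \<Omega> FG by (auto simp: i_adjacent_iff)
  then have 1: "?\<Omega> = adj j A" using i_adjacent_iff_adj[OF A(1) ij(2)] by simp
  have "K \<in> ?\<Omega>" if "K \<in> C" "rk K \<noteq> int i" for K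
  proof (cases "rk K = int j")
    case True
    then show ?thesis using flag_rk_eq[OF C(1) that(1) H(1)] H by simp
  next
    case False
    then show ?thesis using C(4)[OF that(1) False] A(3)[OF _ that(2)] FG by simp
  qed
  \<comment> \<open>If they were equal, the face of rank \<open>i\<close> of \<Phi> would survive in
    \<open>C\<close>, hence lie in \<open>A\<close>, and \<open>A\<close> would be \<Phi>.\<close>
  moreover have "C \<noteq> ?\<Omega>"
  proof
    assume eq: "C = ?\<Omega>"
    have "\<Phi> \<subseteq> A"
    proof
      fix K assume K: "K \<in> \<Phi>"
      show "K \<in> A"
      proof (cases "rk K = int i")
        case True
        then have "K \<in> ?\<Omega>" using C(3)[OF K] ij eq by simp
        then show ?thesis using True H ij by auto
      qed (use A(3) K in auto)
    qed
    then show False using A card_subset_eq[OF flag_finite[OF A(1)]] flag_card \<Phi> by metis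
  qed
  ultimately have "i_adjacent P i C ?\<Omega>" using C(1) \<Omega> unfolding i_adjacent_iff by blast
  then have "?\<Omega> = adj i C" using i_adjacent_iff_adj[OF C(1) ij(1)] by simp
  then show ?thesis using 1 by (simp add: A_def C_def)
qed


subsection \<open>Automorphisms and standard rotations\<close>

abbreviation "Aut \<equiv> polytope_auto P"

lemma carrier_Aut:
  "f \<in> carrier Aut \<longleftrightarrow> f \<in> Bij (Field P) \<and>
    (\<forall>F \<in> Field P. \<forall>G \<in> Field P. (f F, f G) \<in> P \<longleftrightarrow> (F, G) \<in> P)"
  by (simp add: polytope_auto_def)

lemma mult_Aut: "f \<in> carrier Aut \<Longrightarrow> g \<in> carrier Aut \<Longrightarrow> f \<otimes>\<^bsub>Aut\<^esub> g = compose (Field P) f g"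
  by (simp add: polytope_auto_def BijGroup_def)

lemma one_Aut: "\<one>\<^bsub>Aut\<^esub> = (\<lambda>F\<in>Field P. F)"
  by (simp add: polytope_auto_def BijGroup_def)

lemma Aut_face: "f \<in> carrier Aut \<Longrightarrow> F \<in> Field P \<Longrightarrow> f F \<in> Field P"
  using Bij_imp_funcset by (auto simp: carrier_Aut)

lemma Aut_inj: "f \<in> carrier Aut \<Longrightarrow> inj_on f (Field P)"
  by (simp add: carrier_Aut Bij_def bij_betw_def)

lemma group_Aut: "group Aut"
proof -
  interpret B: group "BijGroup (Field P)" by (rule group_BijGroup)
  have "subgroup (carrier Aut) (BijGroup (Field P))"
  proof (rule B.subgroupI)
    show "carrier Aut \<subseteq> carrier (BijGroup (Field P))"
      by (auto simp: carrier_Aut BijGroup_def)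
    have "(\<lambda>F\<in>Field P. F) \<in> carrier Aut" by (auto simp: carrier_Aut id_Bij)
    then show "carrier Aut \<noteq> {}" by blast
  next
    fix f assume f: "f \<in> carrier Aut"
    then have fB: "f \<in> Bij (Field P)" by (simp add: carrier_Aut)
    have inv: "inv\<^bsub>BijGroup (Field P)\<^esub> f = (\<lambda>F\<in>Field P. inv_into (Field P) f F)"
      using fB by (rule inv_BijGroup)
    have "f ` Field P = Field P" using fB by (simp add: Bij_def bij_betw_def)
    then have "(inv_into (Field P) f F, inv_into (Field P) f G) \<in> P \<longleftrightarrow> (F, G) \<in> P"
      if "F \<in> Field P" "G \<in> Field P" for F G
      using that f by (metis carrier_Aut f_inv_into_f inv_into_into)
    then show "inv\<^bsub>BijGroup (Field P)\<^esub> f \<in> carrier Aut"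
      unfolding inv using restrict_inv_into_Bij[OF fB] by (simp add: carrier_Aut)
  next
    fix f g assume fg: "f \<in> carrier Aut" "g \<in> carrier Aut"
    then show "f \<otimes>\<^bsub>BijGroup (Field P)\<^esub> g \<in> carrier Aut"
      using Aut_face[OF fg(2)] compose_Bij[of f "Field P" g]
      by (auto simp: carrier_Aut BijGroup_def compose_eq)
  qed
  then have "group (BijGroup (Field P)\<lparr>carrier := carrier Aut\<rparr>)"
    by (rule subgroup.subgroup_is_group) (rule B.is_group)
  then show ?thesis by (simp add: polytope_auto_def)
qed

sublocale Aut: group Aut by (rule group_Aut)

lemma image_mult_Aut:
  assumes "f \<in> carrier Aut" "g \<in> carrier Aut" "\<Phi> \<subseteq> Field P"
  shows "(f \<otimes>\<^bsub>Aut\<^esub> g) ` \<Phi> = f ` g ` \<Phi>"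
  using assms by (force simp: mult_Aut compose_def)

lemma image_one_Aut: "\<Phi> \<subseteq> Field P \<Longrightarrow> \<one>\<^bsub>Aut\<^esub> ` \<Phi> = \<Phi>"
  by (force simp: one_Aut)

lemma Aut_flag:
  assumes f: "f \<in> carrier Aut" and \<Phi>: "\<Phi> \<in> flags P"
  shows "f ` \<Phi> \<in> flags P"
proof (rule chain_card_flag)
  have "inj_on f \<Phi>" using Aut_inj[OF f] flag_faces[OF \<Phi>] by (rule inj_on_subset)
  then show "card (f ` \<Phi>) = n + 2" by (simp add: card_image flag_card[OF \<Phi>])
  show "f ` \<Phi> \<in> Chains P"
    using flag_total[OF \<Phi>] flag_faces[OF \<Phi>] f by (auto simp: Chains_def carrier_Aut subset_iff)
qed

lemma Aut_rk:
  assumes f: "f \<in> carrier Aut" and F: "F \<in> Field P"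
  shows "rk (f F) = rk F"
proof -
  obtain \<Phi> where \<Phi>: "\<Phi> \<in> flags P" "F \<in> \<Phi>" using F face_in_flag by blast
  have sub: "\<Phi> \<subseteq> Field P" using \<Phi> flag_faces by simp
  have "(f G, f F) \<in> P \<and> f G \<noteq> f F \<longleftrightarrow> (G, F) \<in> P \<and> G \<noteq> F" if "G \<in> \<Phi>" for G
    using that f sub F inj_on_eq_iff[OF Aut_inj[OF f], of G F] by (auto simp: carrier_Aut)
  then have "below (f ` \<Phi>) (f F) = f ` below \<Phi> F" by (auto simp: below_def)
  moreover have "inj_on f (below \<Phi> F)"
    using Aut_inj[OF f] by (rule inj_on_subset) (use sub in \<open>auto simp: below_def\<close>)
  ultimately have "card (below (f ` \<Phi>) (f F)) = card (below \<Phi> F)" by (simp add: card_image)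
  then show ?thesis
    using card_below[OF \<Phi>] card_below[OF Aut_flag[OF f \<Phi>(1)], of "f F"] \<Phi>(2) by simp
qed

text \<open>Automorphisms preserve ranks, so the images are again \<open>i\<close>-adjacent, and the
  \<open>i\<close>-adjacent flag is unique.\<close>

lemma Aut_adj:
  assumes f: "f \<in> carrier Aut" and \<Phi>: "\<Phi> \<in> flags P" and i: "i < n"
  shows "f ` adj i \<Phi> = adj i (f ` \<Phi>)"
proof -
  have adj: "adj i \<Phi> \<in> flags P" "\<Phi> \<noteq> adj i \<Phi>" "\<forall>F\<in>\<Phi>. rk F \<noteq> int i \<longrightarrow> F \<in> adj i \<Phi>"
    using i_adjacent_adj[OF \<Phi> i] by (auto simp: i_adjacent_iff)
  have "f ` \<Phi> \<noteq> f ` adj i \<Phi>"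
    using adj(2) inj_on_image_eq_iff[OF Aut_inj[OF f]] flag_faces \<Phi> adj(1) by metis
  then have "i_adjacent P i (f ` \<Phi>) (f ` adj i \<Phi>)"
    using adj(3) Aut_flag[OF f \<Phi>] Aut_flag[OF f adj(1)] Aut_rk[OF f] flag_faces[OF \<Phi>]
    by (auto simp: i_adjacent_iff subset_iff)
  then show ?thesis using i_adjacent_iff_adj[OF Aut_flag[OF f \<Phi>] i] by simp
qed

section \<open>Free action of the automorphisms on the flags\<close>

lemma Aut_fixes_all_flags:
  assumes f: "f \<in> carrier Aut" and \<Phi>: "\<Phi> \<in> flags P" "f ` \<Phi> = \<Phi>" and \<Psi>: "\<Psi> \<in> flags P"
  shows "f ` \<Psi> = \<Psi>"
proof -
  have "(\<Phi>, \<Psi>) \<in> {(A, B). adjacent P A B \<and> \<Phi> \<inter> \<Psi> \<subseteq> A \<and> \<Phi> \<inter> \<Psi> \<subseteq> B}\<^sup>*"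
    using polytope \<Phi>(1) \<Psi> unfolding abstract_polytope_def strongly_flag_connected_def by blast
  then show ?thesis
  proof induction
    case base
    show ?case by (rule \<Phi>(2))
  next
    case (step A B)
    then have "adjacent P A B" by simp
    then obtain i where i: "i < n" "i_adjacent P i A B" by (rule adjacent_imp_i_adjacent)
    then have A: "A \<in> flags P" by (simp add: i_adjacent_iff)
    then have "B = adj i A" using i i_adjacent_iff_adj by simp
    then show ?case using Aut_adj[OF f A i(1)] step.IH by simp
  qed
qed

text \<open>Being fixed spreads along paths of adjacent flags to all flags. Then \<open>f F\<close>
  lies with \<open>F\<close> in one flag and has the same rank, so it is \<open>F\<close>.
  Extensionality off the face set makes \<open>f\<close> the unit.\<close>

lemma Aut_fixes_flag:
  assumes f: "f \<in> carrier Aut" and \<Phi>: "\<Phi> \<in> flags P" "f ` \<Phi> = \<Phi>"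
  shows "f = \<one>\<^bsub>Aut\<^esub>"
proof -
  have "f F = F" if F: "F \<in> Field P" for F
  proof -
    obtain \<Psi> where \<Psi>: "\<Psi> \<in> flags P" "F \<in> \<Psi>" using F face_in_flag by blast
    then have "f F \<in> \<Psi>" using Aut_fixes_all_flags[OF f \<Phi>] by blast
    then show ?thesis using \<Psi> flag_rk_eq Aut_rk[OF f F] by metis
  qed
  moreover have "f \<in> extensional (Field P)"
    using f Bij_imp_extensional by (auto simp: carrier_Aut)
  ultimately show ?thesis by (auto simp: one_Aut intro: extensionalityI)
qed

lemma Aut_eqI:
  assumes "f \<in> carrier Aut" "g \<in> carrier Aut" "\<Phi> \<in> flags P" "f ` \<Phi> = g ` \<Phi>"
  shows "f = g"
proof -
  have "(inv\<^bsub>Aut\<^esub> g \<otimes>\<^bsub>Aut\<^esub> f) ` \<Phi> = (inv\<^bsub>Aut\<^esub> g) ` g ` \<Phi>"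
    using assms flag_faces by (simp add: image_mult_Aut)
  also have "\<dots> = (inv\<^bsub>Aut\<^esub> g \<otimes>\<^bsub>Aut\<^esub> g) ` \<Phi>"
    using assms by (intro image_mult_Aut[symmetric] flag_faces) auto
  also have "\<dots> = \<Phi>" using assms flag_faces by (simp add: image_one_Aut)
  finally have "inv\<^bsub>Aut\<^esub> g \<otimes>\<^bsub>Aut\<^esub> f = \<one>\<^bsub>Aut\<^esub>"
    using Aut_fixes_flag[of "inv\<^bsub>Aut\<^esub> g \<otimes>\<^bsub>Aut\<^esub> f"] assms by simp
  then show ?thesis using assms by (metis Aut.inv_closed Aut.inv_equality Aut.inv_inv)
qed

section \<open>Flag orbits, reflections and rotations\<close>

lemma flag_orbit_eq: "flag_orbit P \<Phi> = {f ` \<Phi> | f. f \<in> carrier Aut}"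
  by (simp add: flag_orbit_def orbit_def)

lemma flag_in_orbit: "\<Phi> \<in> flags P \<Longrightarrow> \<Phi> \<in> flag_orbit P \<Phi>"
  using image_one_Aut[OF flag_faces] Aut.one_closed by (force simp: flag_orbit_eq)

lemma flag_orbits_eq: "flag_orbits P = flag_orbit P ` flags P"
  by (auto simp: flag_orbits_def orbits_def flag_orbit_def)

text \<open>A single orbit supplies an automorphism and freeness makes it unique, so the description
  in \<open>reflection\<close> denotes it.\<close>

lemma reflection_regular:
  assumes "card (flag_orbits P) = 1" and \<Phi>: "\<Phi> \<in> flags P" and i: "i < n"
  shows "reflection P \<Phi> i \<in> carrier Aut \<and> reflection P \<Phi> i ` \<Phi> = adj i \<Phi>"
proof -
  obtain orb where "flag_orbits P = {orb}" using assms(1) by (rule card_1_singletonE)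
  then have "flag_orbit P (adj i \<Phi>) = flag_orbit P \<Phi>"
    using \<Phi> adj_flag[OF \<Phi> i] unfolding flag_orbits_eq by (metis imageI singletonD)
  then obtain f where "f \<in> carrier Aut" "adj i \<Phi> = f ` \<Phi>"
    using flag_in_orbit[OF adj_flag[OF \<Phi> i]] by (auto simp: flag_orbit_eq)
  then have "\<exists>!f. f \<in> carrier Aut \<and> f ` \<Phi> = adj i \<Phi>"
    using Aut_eqI[OF _ _ \<Phi>] by metis
  then show ?thesis
    unfolding reflection_def i_adjacent_iff_adj[OF \<Phi> i] by (rule theI')
qed

text \<open>This gives both cases of \<open>rotation\<close> the same action on the base flag, and
  everything later uses only that action.\<close>

lemma rotation_flag:
  assumes orbits: "chiral_polytope n P \<or> directly_regular_polytope n P \<Theta>"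
    and \<Phi>: "\<Phi> \<in> flags P" and i: "i \<in> {1..<n}"
  shows "rotation P \<Phi> i \<in> carrier Aut \<and> rotation P \<Phi> i ` \<Phi> = adj i (adj (i - 1) \<Phi>)"
proof (cases "card (flag_orbits P) = 1")
  case True
  have ii: "i < n" "i - 1 < n" using i by auto
  note r = reflection_regular[OF True \<Phi> ii(1)] reflection_regular[OF True \<Phi> ii(2)]
  \<comment> \<open>The right factor acts first and gives \<open>adj i \<Phi>\<close>; the left one
    commutes with \<open>adj i\<close> and moves \<Phi> to
    \<open>adj (i - 1) \<Phi>\<close>.\<close>
  have "(reflection P \<Phi> (i - 1) \<otimes>\<^bsub>Aut\<^esub> reflection P \<Phi> i) ` \<Phi> = adj i (adj (i - 1) \<Phi>)"
    using r Aut_adj[OF _ \<Phi> ii(1)] by (simp add: image_mult_Aut flag_faces[OF \<Phi>])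
  then show ?thesis using r True by (simp add: rotation_def)
next
  case False
  then have chiral: "card (flag_orbits P) = 2"
    and distinct: "\<And>\<Phi> \<Psi>. adjacent P \<Phi> \<Psi> \<Longrightarrow> flag_orbit P \<Phi> \<noteq> flag_orbit P \<Psi>"
    using orbits
    by (auto simp: chiral_polytope_def directly_regular_polytope_def regular_polytope_def)
  have ii: "i < n" "i - 1 < n" using i by auto
  define A where "A = adj (i - 1) \<Phi>"
  define B where "B = adj i A"
  have A: "A \<in> flags P" "adjacent P \<Phi> A"
    using adj_flag[OF \<Phi> ii(2)] i_adjacent_adj[OF \<Phi> ii(2)] by (auto simp: A_def i_adjacent_def)
  have B: "B \<in> flags P" "adjacent P A B"
    using adj_flag[OF A(1) ii(1)] i_adjacent_adj[OF A(1) ii(1)] by (auto simp: B_def i_adjacent_def)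
  have "flag_orbit P \<Phi> \<noteq> flag_orbit P A" "flag_orbit P A \<noteq> flag_orbit P B"
    using A B distinct by auto
  moreover have "flag_orbit P \<Phi> \<in> flag_orbits P" "flag_orbit P A \<in> flag_orbits P"
    "flag_orbit P B \<in> flag_orbits P"
    using A B \<Phi> by (auto simp: flag_orbits_eq)
  \<comment> \<open>Each of the two adjacencies changes the orbit, and there are only two orbits, so
    \<open>B\<close> is back in that of \<Phi>.\<close>
  ultimately have "flag_orbit P B = flag_orbit P \<Phi>"
    using chiral by (auto simp: card_2_iff)
  then obtain f where "f \<in> carrier Aut" "B = f ` \<Phi>"
    using flag_in_orbit[OF B(1)] by (auto simp: flag_orbit_eq)
  then have "\<exists>!f. f \<in> carrier Aut \<and> f ` \<Phi> = B" using Aut_eqI[OF _ _ \<Phi>] by metis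
  moreover have "(\<exists>\<Psi>. i_adjacent P (i - 1) \<Phi> \<Psi> \<and> i_adjacent P i \<Psi> \<Omega>) \<longleftrightarrow> \<Omega> = B" for \<Omega>
    using i_adjacent_iff_adj[OF \<Phi> ii(2)] i_adjacent_iff_adj[OF A(1) ii(1)]
    by (auto simp: A_def B_def)
  ultimately show ?thesis
    using False theI'[of "\<lambda>f. f \<in> carrier Aut \<and> f ` \<Phi> = B"]
    by (simp add: rotation_def A_def B_def)
qed

end


section \<open>Orders of homomorphic images\<close>

text \<open>On \<open>A\<close> the kernel of \<open>f\<close> lies in that of \<open>g\<close>, so
  \<open>g\<close> factors through \<open>f\<close> and \<open>g\<close>
  A\<open>is a quotient of\<close>f \<open>A\<close>. The first isomorphism theorem and Lagrange's
  theorem give the divisibility.\<close>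

lemma card_image_dvd_card_image:
  assumes f: "group_hom G H f" and g: "group_hom G K g" and A: "subgroup A G"
    and ker: "\<And>x. x \<in> A \<Longrightarrow> f x = \<one>\<^bsub>H\<^esub> \<Longrightarrow> g x = \<one>\<^bsub>K\<^esub>"
  shows "card (g ` A) dvd card (f ` A)"
proof -
  interpret f: group_hom G H f by (rule f)
  interpret g: group_hom G K g by (rule g)
  interpret A: subgroup A G by (rule A)
  let ?H = "H\<lparr>carrier := f ` A\<rparr>" and ?K = "K\<lparr>carrier := g ` A\<rparr>"
  have fA: "group (?H)" and gA: "group (?K)"
    using f.subgroup_img_is_subgroup[OF A] g.subgroup_img_is_subgroup[OF A]
    by (auto intro: subgroup.subgroup_is_group)
  define h where "h y = g (SOME x. x \<in> A \<and> f x = y)" for y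
  have h: "h (f x) = g x" if x: "x \<in> A" for x
  proof -
    define z where "z = (SOME z. z \<in> A \<and> f z = f x)"
    have z: "z \<in> A" "f z = f x"
      using someI[of "\<lambda>z. z \<in> A \<and> f z = f x" x] x by (auto simp: z_def)
    \<comment> \<open>Two preimages of one point differ by an element of the kernel of
      \<open>f\<close>, so \<open>h\<close> does not depend on the choice.\<close>
    have "f (z \<otimes>\<^bsub>G\<^esub> inv\<^bsub>G\<^esub> x) = \<one>\<^bsub>H\<^esub>" using x z by simp
    then have "g (z \<otimes>\<^bsub>G\<^esub> inv\<^bsub>G\<^esub> x) = \<one>\<^bsub>K\<^esub>" using x z by (intro ker) auto
    then have "g z = g x"
      using x z by (simp add: g.H.inv_solve_right')
    then show ?thesis by (simp add: h_def z_def)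
  qed
  have "h \<in> hom (?H) (?K)"
  proof (rule homI; clarsimp)
    fix x assume "x \<in> A"
    then show "h (f x) \<in> g ` A" by (simp add: h)
  next
    fix x y assume xy: "x \<in> A" "y \<in> A"
    then have "h (f x \<otimes>\<^bsub>H\<^esub> f y) = h (f (x \<otimes>\<^bsub>G\<^esub> y))" by simp
    also have "\<dots> = g x \<otimes>\<^bsub>K\<^esub> g y" using xy by (subst h) auto
    finally show "h (f x \<otimes>\<^bsub>H\<^esub> f y) = h (f x) \<otimes>\<^bsub>K\<^esub> h (f y)" using xy by (simp add: h)
  qed
  then interpret h: group_hom "?H" "?K" h
    using fA gA by (simp add: group_hom_def group_hom_axioms_def)
  have "h ` f ` A = g ` A" using h by (force simp: image_image)
  then have "(\<lambda>C. the_elem (h ` C)) \<in> iso (?H Mod kernel ?H ?K h) ?K"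
    by (intro h.FactGroup_iso_set) simp
  then have "card (carrier (?H Mod kernel ?H ?K h)) = card (g ` A)"
    by (auto simp: iso_def dest!: bij_betw_same_card)
  moreover have "card (carrier (?H Mod kernel ?H ?K h)) * card (kernel ?H ?K h) = card (f ` A)"
    using h.G.lagrange[OF h.subgroup_kernel] by (simp add: order_def FactGroup_def)
  ultimately show ?thesis by (metis dvd_triv_left)
qed

lemma order_kernel_dvd:
  fixes W (structure)
  assumes W: "group W" and bar: "b \<in> hom W W" "\<And>x. x \<in> carrier W \<Longrightarrow> b (b x) = x"
    and M: "M \<lhd> W" and H: "group H" and \<psi>: "\<psi> \<in> hom W H"
    and invariant: "b ` (M \<inter> kernel W H \<psi>) = M \<inter> kernel W H \<psi>"
  defines "MM \<equiv> M <#> (b ` M)"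
  shows "card (kernel (W Mod M) (W Mod MM) (\<lambda>A. A <#> MM)) dvd order H"
proof -
  interpret W: group W by (rule W)
  interpret H: group H by (rule H)
  interpret M: normal M W by (rule M)
  interpret b: group_hom W W b using bar W by (simp add: group_hom_def group_hom_axioms_def)
  interpret \<psi>: group_hom W H \<psi> using \<psi> W H by (simp add: group_hom_def group_hom_axioms_def)
  have B: "subgroup (b ` M) W" by (rule b.subgroup_img_is_subgroup) (rule M.subgroup_axioms)
  have MM: "subgroup MM W"
    unfolding MM_def using M B
    by (intro second_isomorphism_grp.normal_set_mult_subgroup)
      (simp add: second_isomorphism_grp_def second_isomorphism_grp_axioms_def)
  \<comment> \<open>The unit of \<open>W Mod MM\<close> is \<open>MM\<close>, so this describes the
    kernel as the cosets of elements of \<open>MM\<close>.\<close>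
  have eq: "(M #> x) <#> MM = MM \<longleftrightarrow> x \<in> MM" if x: "x \<in> carrier W" for x
  proof
    assume e: "(M #> x) <#> MM = MM"
    have "x \<in> M #> x" using W.rcos_self[OF x M.subgroup_axioms] .
    then have "x \<otimes> \<one> \<in> (M #> x) <#> MM"
      unfolding set_mult_def using subgroup.one_closed[OF MM] by blast
    then show "x \<in> MM" using e x by simp
  next
    assume xMM: "x \<in> MM"
    have "M \<subseteq> MM"
    proof
      fix m assume "m \<in> M"
      then have "m \<otimes> \<one> \<in> MM"
        unfolding MM_def set_mult_def using subgroup.one_closed[OF B] by blast
      then show "m \<in> MM" using \<open>m \<in> M\<close> by simp
    qed
    then have "(M #> x) <#> MM \<subseteq> MM"
      using xMM subgroup.m_closed[OF MM] by (auto simp: set_mult_def r_coset_def)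
    moreover have "MM \<subseteq> (M #> x) <#> MM"
    proof
      fix k assume k: "k \<in> MM"
      have "x \<otimes> (inv x \<otimes> k) \<in> (M #> x) <#> MM"
        unfolding set_mult_def using W.rcos_self[OF x M.subgroup_axioms]
          subgroup.m_closed[OF MM subgroup.m_inv_closed[OF MM xMM] k] by blast
      then show "k \<in> (M #> x) <#> MM"
        using x subgroup.mem_carrier[OF MM k] by (simp add: W.m_assoc[symmetric])
    qed
    ultimately show "(M #> x) <#> MM = MM" by blast
  qed
  have "kernel (W Mod M) (W Mod MM) (\<lambda>A. A <#> MM) = (\<lambda>x. M #> x) ` MM"
    using eq subgroup.mem_carrier[OF MM] by (auto simp: kernel_def FactGroup_def RCOSETS_def)
  also have "\<dots> = (\<lambda>x. M #> x) ` b ` M"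
  proof -
    have "M #> x \<in> (\<lambda>x. M #> x) ` b ` M" if xMM: "x \<in> MM" for x
    proof -
      obtain m c where x: "m \<in> M" "c \<in> b ` M" "x = m \<otimes> c"
        using xMM unfolding MM_def set_mult_def by blast
      have "M #> x = M #> c"
        using W.coset_mult_assoc[OF M.subset, of m c] subgroup.mem_carrier[OF B x(2)] x
        by (simp add: W.coset_join2 M.subgroup_axioms)
      then show ?thesis using x(2) by blast
    qed
    moreover have "c \<in> MM" if "c \<in> b ` M" for c
    proof -
      have "\<one> \<otimes> c \<in> MM" unfolding MM_def set_mult_def using that M.one_closed by blast
      then show ?thesis using that subgroup.mem_carrier[OF B] by simp
    qed
    ultimately show ?thesis by blast
  qed
  also have "card \<dots> dvd card ((\<psi> \<circ> b) ` b ` M)"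
  proof (rule card_image_dvd_card_image[OF _ _ B])
    show "group_hom W H (\<psi> \<circ> b)"
      using Group.hom_compose[OF bar(1) \<psi>] W H by (simp add: group_hom_def group_hom_axioms_def)
    show "group_hom W (W Mod M) (\<lambda>x. M #> x)"
      using W M.factorgroup_is_group M.r_coset_hom_Mod
      by (simp add: group_hom_def group_hom_axioms_def)
    fix x assume x: "x \<in> b ` M" "(\<psi> \<circ> b) x = \<one>\<^bsub>H\<^esub>"
    then obtain m where m: "m \<in> M" "x = b m" by blast
    then have "m \<in> M \<inter> kernel W H \<psi>" using x bar(2) by (simp add: kernel_def)
    \<comment> \<open>Here the invariance enters: \<open>b m\<close> lies in the image of the
      intersection, which is the intersection itself and so inside \<open>M\<close>.\<close>
    then have "x \<in> M" using invariant m by blast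
    then show "M #> x = \<one>\<^bsub>W Mod M\<^esub>" by (simp add: FactGroup_def W.coset_join2 M.subgroup_axioms)
  qed
  also have "(\<psi> \<circ> b) ` b ` M = \<psi> ` M"
    using bar(2) by (force simp: image_image)
  also have "card (\<psi> ` M) dvd order H"
    using H.lagrange[OF \<psi>.subgroup_img_is_subgroup[OF M.subgroup_axioms]] by (metis dvd_triv_right)
  finally show ?thesis .
qed


section \<open>Quotients of \<open>W\<^sup>+\<close> and their mixes\<close>

text \<open>The \<open>s i\<close> only have to satisfy the relations, not to generate
  \<open>G\<close>. Thus the locale also covers the full automorphism group and a direct product,
  from which it passes to the generated subgroups.\<close>

locale Wplus_quotient = group G for G (structure) +
  fixes n :: nat and s :: "nat \<Rightarrow> 'a"
  assumes gens: "s ` {1..<n} \<subseteq> carrier G"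
    and relators: "r \<in> Wplus_relators n \<Longrightarrow> word_value G s r = \<one>"
begin

lemma induced_hom_class:
  "w \<in> lists ({1..<n} \<times> UNIV) \<Longrightarrow> induced_hom G s (Wplus_class n w) = word_value G s w"
  by (rule induced_hom_word_class[OF gens relators])

lemma induced_hom: "induced_hom G s \<in> hom (Wplus n) G"
  unfolding Wplus_def by (rule induced_hom_hom[OF gens relators])

lemma relation_subgroup_normal: "relation_subgroup n G s \<lhd> Wplus n"
  unfolding relation_subgroup_def
  using induced_hom group_Wplus
  by (intro group_hom.normal_kernel) (simp add: group_hom_def group_hom_axioms_def)

lemma class_in_relation_subgroup:
  assumes w: "w \<in> lists ({1..<n} \<times> UNIV)"
  shows "Wplus_class n w \<in> relation_subgroup n G s \<longleftrightarrow> word_value G s w = \<one>"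
  using induced_hom_class[OF w] word_class_in_carrier[OF w]
  by (simp add: relation_subgroup_def kernel_def Wplus_def)

end

section \<open>Mixes and intersections of relation subgroups\<close>

lemma (in group) word_value_subgroup_generated:
  assumes s: "s ` S \<subseteq> T" "T \<subseteq> carrier G" and w: "w \<in> lists (S \<times> UNIV)"
  shows "word_value (subgroup_generated G T) s w = word_value G s w"
proof -
  have "s x \<in> carrier (subgroup_generated G T)" if "x \<in> S" for x
    using that s subgroup_generated_subset_carrier_subset[OF s(2)] by blast
  then show ?thesis using w by (induction w) auto
qed

lemma word_value_DirProd:
  assumes "group G" "group H" "s ` S \<subseteq> carrier G" "t ` S \<subseteq> carrier H"
    and "w \<in> lists (S \<times> UNIV)"
  shows "word_value (G \<times>\<times> H) (\<lambda>i. (s i, t i)) w = (word_value G s w, word_value H t w)"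
  using assms(5)
proof (induction w)
  case (Cons a w)
  then show ?case using assms(1-4) by (cases a) (auto simp: image_subset_iff)
qed simp

lemma Wplus_relators_lists: "r \<in> Wplus_relators n \<Longrightarrow> r \<in> lists ({1..<n} \<times> UNIV)"
  by (auto simp: Wplus_relators_def)

lemma Wplus_quotient_subgroup_generated:
  assumes "Wplus_quotient G n s"
  shows "Wplus_quotient (subgroup_generated G (s ` {1..<n})) n s"
proof -
  interpret Wplus_quotient G n s by (rule assms)
  show ?thesis
    using subgroup_generated_subset_carrier_subset[OF gens] relators
      word_value_subgroup_generated[OF subset_refl gens Wplus_relators_lists]
    by (simp add: Wplus_quotient_def Wplus_quotient_axioms_def)
qed

text \<open>Words are evaluated componentwise in the direct product, and passing to the generated
  subgroup changes neither values nor unit. So a word is trivial in the mix exactly if it is trivial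
  in both factors.\<close>

lemma relation_subgroup_mix:
  assumes "Wplus_quotient G n s" "Wplus_quotient H n t"
  defines "D \<equiv> subgroup_generated (G \<times>\<times> H) ((\<lambda>i. (s i, t i)) ` {1..<n})"
  shows "relation_subgroup n D (\<lambda>i. (s i, t i)) = relation_subgroup n G s \<inter> relation_subgroup n H t"
proof -
  interpret G: Wplus_quotient G n s by (rule assms)
  interpret H: Wplus_quotient H n t by (rule assms)
  have val: "word_value (G \<times>\<times> H) (\<lambda>i. (s i, t i)) w = (word_value G s w, word_value H t w)"
    if "w \<in> lists ({1..<n} \<times> UNIV)" for w
    using that by (rule word_value_DirProd[OF G.group_axioms H.group_axioms G.gens H.gens])
  interpret GH: group "G \<times>\<times> H" by (rule DirProd_group[OF G.group_axioms H.group_axioms])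
  have gens: "(\<lambda>i. (s i, t i)) ` {1..<n} \<subseteq> carrier (G \<times>\<times> H)" using G.gens H.gens by auto
  then have "Wplus_quotient (G \<times>\<times> H) n (\<lambda>i. (s i, t i))"
    by unfold_locales (simp_all add: val[OF Wplus_relators_lists] G.relators H.relators)
  then interpret D: Wplus_quotient D n "\<lambda>i. (s i, t i)"
    unfolding D_def by (rule Wplus_quotient_subgroup_generated)
  have valueD: "word_value D (\<lambda>i. (s i, t i)) w = (word_value G s w, word_value H t w)"
    if "w \<in> lists ({1..<n} \<times> UNIV)" for w
    unfolding D_def
    using GH.word_value_subgroup_generated[OF subset_refl gens that] val[OF that] by (rule HOL.trans)
  have one: "\<one>\<^bsub>D\<^esub> = (\<one>\<^bsub>G\<^esub>, \<one>\<^bsub>H\<^esub>)" by (simp add: D_def)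
  show "relation_subgroup n D (\<lambda>i. (s i, t i)) = relation_subgroup n G s \<inter> relation_subgroup n H t"
  proof (rule Set.set_eqI)
    fix A
    show "A \<in> relation_subgroup n D (\<lambda>i. (s i, t i)) \<longleftrightarrow>
        A \<in> relation_subgroup n G s \<inter> relation_subgroup n H t"
    proof (cases "\<exists>w \<in> lists ({1..<n} \<times> UNIV). A = Wplus_class n w")
      case True
      then obtain w where w: "w \<in> lists ({1..<n} \<times> UNIV)" "A = Wplus_class n w" by blast
      show ?thesis
        unfolding w(2) Int_iff D.class_in_relation_subgroup[OF w(1)]
          G.class_in_relation_subgroup[OF w(1)] H.class_in_relation_subgroup[OF w(1)]
          valueD[OF w(1)] one by simp
    next
      case False
      \<comment> \<open>A set that is no class lies outside the carrier of \<open>Wplus n\<close>,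
        hence in none of the three kernels.\<close>
      then show ?thesis by (auto simp: relation_subgroup_def kernel_def Wplus_def carrier_presented_group)
    qed
  qed
qed

lemma chirality_order_dvd:
  assumes "Wplus_quotient G n s" "Wplus_quotient H n t"
    and invariant: "Wbar n ` (relation_subgroup n G s \<inter> relation_subgroup n H t) =
      relation_subgroup n G s \<inter> relation_subgroup n H t"
  defines "M \<equiv> relation_subgroup n G s"
  defines "MM \<equiv> M <#>\<^bsub>Wplus n\<^esub> (Wbar n ` M)"
  shows "card (kernel (Wplus n Mod M) (Wplus n Mod MM) (\<lambda>A. A <#>\<^bsub>Wplus n\<^esub> MM)) dvd order H"
proof -
  interpret G: Wplus_quotient G n s by (rule assms)
  interpret H: Wplus_quotient H n t by (rule assms)
  show ?thesis
    unfolding MM_def M_def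
    by (rule order_kernel_dvd[OF group_Wplus Wbar_hom Wbar_Wbar G.relation_subgroup_normal
          H.group_axioms H.induced_hom invariant[unfolded relation_subgroup_def[of n H t]]])
qed


section \<open>Rotation groups of polytopes\<close>

context finite_polytope
begin

lemma segment_rotations_flag:
  assumes s: "\<And>i. i \<in> {1..<n} \<Longrightarrow> s i \<in> carrier Aut \<and> s i ` \<Phi> = adj i (adj (i - 1) \<Phi>)"
    and \<Phi>: "\<Phi> \<in> flags P" and i: "1 \<le> i" and ij: "i \<le> Suc j" and j: "j < n"
  shows "word_value Aut s (segment i j) ` \<Phi> = adj j (adj (i - 1) \<Phi>)"
  using ij
proof (induction rule: inc_induct)
  case base
  \<comment> \<open>The segment is empty here, and its index \<open>Suc j - 1\<close> is
    \<open>j\<close>, so the two adjacencies cancel.\<close>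
  show ?case using j adj_adj[OF \<Phi>, of j] image_one_Aut[OF flag_faces[OF \<Phi>]] by simp
next
  case (step k)
  have k: "k \<in> {1..<n}" "k - 1 < n" "k < n" using step.hyps i j by auto
  let ?v = "word_value Aut s (segment (Suc k) j)"
  have v: "?v \<in> carrier Aut"
    using s j by (intro Aut.word_value_closed[of s "{1..<n}"] segment_lists) auto
  have "word_value Aut s (segment k j) ` \<Phi> = s k ` ?v ` \<Phi>"
    using step.hyps s[OF k(1)] v flag_faces[OF \<Phi>]
    by (simp add: segment_Cons image_mult_Aut del: upt_Suc)
  also have "\<dots> = s k ` adj j (adj k \<Phi>)" using step.IH by simp
  \<comment> \<open>The automorphism \<open>s k\<close> passes through both adjacencies to \<Phi>;
    there \<open>adj k\<close> meets the \<open>adj k\<close> of its own action and cancels.\<close>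
  also have "\<dots> = adj j (adj k (s k ` \<Phi>))"
    using s[OF k(1)] \<Phi> k j by (simp add: Aut_adj adj_flag)
  also have "\<dots> = adj j (adj (k - 1) \<Phi>)"
    using s[OF k(1)] \<Phi> k by (simp add: adj_adj adj_flag)
  finally show ?case .
qed

text \<open>By freeness each relator has to be checked only on the base flag, where it becomes a
  word in adjacencies.\<close>

lemma rotations_Wplus_quotient:
  assumes s: "\<And>i. i \<in> {1..<n} \<Longrightarrow> s i \<in> carrier Aut \<and> s i ` \<Phi> = adj i (adj (i - 1) \<Phi>)"
    and \<Phi>: "\<Phi> \<in> flags P"
  shows "Wplus_quotient Aut n s"
proof
  show gens: "s ` {1..<n} \<subseteq> carrier Aut" using s by blast
  fix r assume "r \<in> Wplus_relators n"
  then show "word_value Aut s r = \<one>\<^bsub>Aut\<^esub>"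
  proof (rule Aut.Wplus_relators_value[OF gens, rotated])
    fix i j assume ij: "1 \<le> i" "i < j" "j < n"
    let ?v = "word_value Aut s (segment i j)"
    have v: "?v \<in> carrier Aut"
      using ij by (intro Aut.word_value_closed[OF gens] segment_lists) auto
    have v\<Phi>: "?v ` \<Phi> = adj j (adj (i - 1) \<Phi>)"
      using ij by (intro segment_rotations_flag[OF s \<Phi>]) auto
    have i: "i - 1 < n" using ij by simp
    have "(?v \<otimes>\<^bsub>Aut\<^esub> ?v) ` \<Phi> = adj j (adj (i - 1) (?v ` \<Phi>))"
      using v v\<Phi> \<Phi> ij i by (simp add: image_mult_Aut flag_faces Aut_adj adj_flag)
    \<comment> \<open>From \<open>1 \<le> i\<close> and \<open>i < j\<close> the indices
      \<open>i - 1\<close> and \<open>j\<close> differ by at least 2, as \<open>adj_commute\<close>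
      requires.\<close>
    also have "\<dots> = adj j (adj j (adj (i - 1) (adj (i - 1) \<Phi>)))"
      unfolding v\<Phi> using \<Phi> ij i by (subst adj_commute[of _ "i - 1" j]) (auto simp: adj_flag)
    also have "\<dots> = \<Phi>" using \<Phi> ij i by (simp add: adj_adj)
    finally show "?v \<otimes>\<^bsub>Aut\<^esub> ?v = \<one>\<^bsub>Aut\<^esub>"
      using v \<Phi> by (intro Aut_fixes_flag) auto
  qed
qed

lemma rotation_group_Wplus_quotient:
  assumes "chiral_polytope n P \<or> directly_regular_polytope n P \<Phi>" "\<Phi> \<in> flags P"
  shows "Wplus_quotient (rotation_group n P \<Phi>) n (rotation P \<Phi>)"
  unfolding rotation_group_def
  using rotations_Wplus_quotient[OF rotation_flag[OF assms] assms(2)]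
  by (rule Wplus_quotient_subgroup_generated)

end

lemma order_chirality_group:
  "order (chirality_group n P \<Phi>) =
    card (kernel (Wplus n Mod polytope_relations n P \<Phi>)
      (Wplus n Mod (polytope_relations n P \<Phi> <#>\<^bsub>Wplus n\<^esub> (Wbar n ` polytope_relations n P \<Phi>)))
      (\<lambda>A. A <#>\<^bsub>Wplus n\<^esub> (polytope_relations n P \<Phi> <#>\<^bsub>Wplus n\<^esub> (Wbar n ` polytope_relations n P \<Phi>))))"
  by (simp add: chirality_group_def Let_def order_def)

theorem theorem4p2:
  fixes P :: "'a rel" and Q :: "'b rel" and n :: nat
    and \<Phi> :: "'a set" and \<Psi> :: "'b set"
  assumes "finite (Field P)" and "finite (Field Q)"
    and "\<Phi> \<in> flags P" and "\<Psi> \<in> flags Q"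
    and "chiral_polytope n P \<or> directly_regular_polytope n P \<Phi>"
    and "chiral_polytope n Q \<or> directly_regular_polytope n Q \<Psi>"
    and "\<not> (directly_regular_polytope n P \<Phi> \<and> directly_regular_polytope n Q \<Psi>)"
    and "\<not> order (chirality_group n P \<Phi>) dvd order (rotation_group n Q \<Psi>) \<or>
         \<not> order (chirality_group n Q \<Psi>) dvd order (rotation_group n P \<Phi>)"
  shows "mix_chiral n P \<Phi> Q \<Psi>"
proof (rule ccontr)
  assume "\<not> mix_chiral n P \<Phi> Q \<Psi>"
  then have invariant: "Wbar n ` mix_relations n P \<Phi> Q \<Psi> = mix_relations n P \<Phi> Q \<Psi>"
    by (simp add: mix_chiral_def mix_directly_regular_def)
  have "abstract_polytope n P" "abstract_polytope n Q"
    using assms(5,6)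
    by (auto simp: chiral_polytope_def directly_regular_polytope_def regular_polytope_def)
  then interpret P: finite_polytope n P + Q: finite_polytope n Q
    using assms(1,2) by (simp_all add: finite_polytope_def)
  have quot: "Wplus_quotient (rotation_group n P \<Phi>) n (rotation P \<Phi>)"
    "Wplus_quotient (rotation_group n Q \<Psi>) n (rotation Q \<Psi>)"
    using assms by (auto intro: P.rotation_group_Wplus_quotient Q.rotation_group_Wplus_quotient)
  have "mix_relations n P \<Phi> Q \<Psi> = polytope_relations n P \<Phi> \<inter> polytope_relations n Q \<Psi>"
    using relation_subgroup_mix[OF quot]
    by (simp add: mix_relations_def mix_rotation_group_def mix_generator_def[abs_def]
        polytope_relations_def)
  note invariant = invariant[unfolded this polytope_relations_def]
  have "order (chirality_group n P \<Phi>) dvd order (rotation_group n Q \<Psi>)"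
    unfolding order_chirality_group polytope_relations_def
    using quot invariant by (rule chirality_order_dvd)
  \<comment> \<open>The roles are exchanged. The instance of \<open>Int_commute\<close> matches only
    intersections with the subgroup of \<open>P\<close> on the left, so each is swapped
    once.\<close>
  moreover have "order (chirality_group n Q \<Psi>) dvd order (rotation_group n P \<Phi>)"
    unfolding order_chirality_group polytope_relations_def
    using quot(2,1) invariant[unfolded Int_commute[of "relation_subgroup n (rotation_group n P \<Phi>) _"]]
    by (rule chirality_order_dvd)
  ultimately show False using assms(8) by simp
qed

end
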